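(* Let $P:S\to S$ be a Poincaré map for the ODE $u'(t)=f(u(t))$ on a section $S\subset\mathbb{R}^d$, let $N=\{N_1,\dots,N_n\}$ be a finite collection of h-sets in $S$, and let $C\subset N\times N$ be a collection of covering relations on $N$ for $P$, i.e. $N_i\overset{P}{\Longrightarrow}N_j$ for every $(N_i,N_j)\in C$. For $\varepsilon\in\mathbb{R}$ define the h-sets with tails $\bar N^\varepsilon_i=N_i\times\Omega_{\mathcal{L}(M_f+|\varepsilon|M_g)}$ (head $N_i$, tail $\Omega_{\mathcal{L}(M_f+|\varepsilon|M_g)}$), and put $\bar N^\varepsilon=\{\bar N_i^\varepsilon: N_i\in N\}$ and $\bar C^\varepsilon=\{(\bar N^\varepsilon_i,\bar N^\varepsilon_j):(N_i,N_j)\in C\}$. Then there exists $\varepsilon_C>0$ such that for every $\varepsilon$ with $|\varepsilon|\le\varepsilon_C$ the return map $\bar P$ on the section $\bar S=\{\phi\in\mathcal{C}:\phi(0)\in S\}$ for the semiflow of the DDE $u'(t)=f(u(t))+\varepsilon\,g(u(t-\tau))$ is well defined on all the sets $\bar N_i^\varepsilon$, and $\bar C^\varepsilon$ is a collection of covering relations on $\bar N^\varepsilon$ for $\bar P$, i.e. $\bar N_i^\varepsilon\overset{\bar P}{\Longrightarrow}\bar N_j^\varepsilon$ for every $(N_i,N_j)\in C$.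
   Context: **Equations.** Fix $d\ge 3$ and $\tau>0$. $\|\cdot\|$ is the maximum norm on $\mathbb{R}^d$, and $\mathcal{C}=C([-\tau,0],\mathbb{R}^d)$ carries the norm $\|\phi\|_\infty=\max_{t\in[-\tau,0]}\|\phi(t)\|$. The maps $f,g:\mathbb{R}^d\to\mathbb{R}^d$ are continuous, bounded ($\|f(u)\|\le M_f$, $\|g(u)\|\le M_g$ for all $u$) and Lipschitz with constants $L_f$, $L_g$; all constants are positive. $\Phi$ is the flow on $\mathbb{R}^d$ of $u'=f(u)$. For $\varepsilon\in\mathbb{R}$, $\varphi_\varepsilon:[0,\infty)\times\mathcal{C}\to\mathcal{C}$ is the semiflow of the DDE: $\varphi_\varepsilon(t,\phi)=\bar u_t$, where $\bar u:[-\tau,\infty)\to\mathbb{R}^d$ is the solution with $\bar u|_{[-\tau,0]}=\phi$ and $\bar u_t(s)=\bar u(t+s)$ for $s\in[-\tau,0]$. **Lipschitz tails.** $\Omega_{\mathcal{L}(L)}$ is the set of $\eta\in\mathcal{C}$ with $\eta(0)=0$ and $\|\eta(t_2)-\eta(t_1)\|\le L|t_2-t_1|$ for all $t_1,t_2\in[-\tau,0]$. Elements $\phi\in\mathcal{C}$ are written in coordinates $(\phi(0),\phi-\phi(0))\in\mathbb{R}^d\times\mathcal{X}_2$, where $\mathcal{X}_2=\{\eta\in\mathcal{C}:\eta(0)=0\}$; for $K\subset\mathbb{R}^d$, $K\times\Omega_{\mathcal{L}(L)}$ denotes the set of those $\phi$ with $\phi(0)\in K$ and $\phi-\phi(0)\in\Omega_{\mathcal{L}(L)}$.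 **Section and Poincaré map.** A section $S$ for $\Phi$ is a $(d-1)$-dimensional smooth submanifold of $\mathbb{R}^d$ for which there exist $\delta>0$ and a $C^1$ function $\alpha:U\to\mathbb{R}$ such that: (1) $\Phi|_{(-\delta,\delta)\times S}$ is a homeomorphism onto $U=\Phi((-\delta,\delta)\times S)$; (2) $S=\alpha^{-1}(0)\cap U$; (3) for some $a>0$, $\nabla\alpha(u)\cdot f(u)\ge a$ for all $u\in U$; (4) $\alpha<0$ on $\Phi((-\delta,0)\times S)$ and $\alpha>0$ on $\Phi((0,\delta)\times S)$. Every point of $S$ is assumed to return to $S$; $t_P(u)=\inf\{t>0:\Phi(t,u)\in S\}$ and $P(u)=\Phi(t_P(u),u)$; $t_P$ and $P$ are continuous. The return map $\bar P$ is as follows. Fix $\eta\in(0,\delta)$ and let $K=\bigcup_i|N_i|$. For $\phi\in\mathcal{C}$ with $\phi(0)\in K$, $t_{\bar P}(\phi)$ is the unique $t\in[t_P(\phi(0))-\eta,\,t_P(\phi(0))+\eta]$ with $\varphi_\varepsilon(t,\phi)(0)\in S$ (it exists and is unique for $|\varepsilon|$ small), and $\bar P(\phi)=\varphi_\varepsilon(t_{\bar P}(\phi),\phi)$. $S$ is identified with an open subset of $\mathbb{R}^{d-1}$ by a fixed coordinate diffeomorphism; correspondingly $\bar S$ is identified with a subset of $\mathcal{X}=\mathbb{R}^{d-1}\times\mathcal{X}_2$. h-sets in $S$ are h-sets in $\mathbb{R}^{d-1}$ with support contained in $S$. **h-sets.** An h-set $N$ in $\mathbb{R}^{k}$ ($k\ge2$)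 is a pair $(|N|,c_N)$ with $|N|\subset\mathbb{R}^k$ compact and $c_N:\mathbb{R}^k\to\mathbb{R}^k=\mathbb{R}\times\mathbb{R}^{k-1}$ a homeomorphism such that $c_N(|N|)=[-1,1]\times\overline{\mathbb{B}}_{k-1}$, where $\overline{\mathbb{B}}_{k-1}$ is the closed unit ball of $\mathbb{R}^{k-1}$ in the max norm. Put $N^-=c_N^{-1}(\{-1,1\}\times\overline{\mathbb{B}}_{k-1})$ and $N^+=c_N^{-1}([-1,1]\times\partial\overline{\mathbb{B}}_{k-1})$. **Covering, finite dimension.** For h-sets $N,M$ in $\mathbb{R}^k$ and a continuous $F:|N|\to\mathbb{R}^k$, $N\overset{F}{\Longrightarrow}M$ means that there is a continuous homotopy $H:[0,1]\times|N|\to\mathbb{R}^k$ with $H(0,\cdot)=F$; $H([0,1],N^-)\cap|M|=\varnothing$; $H([0,1],|N|)\cap M^+=\varnothing$; and for some $a\in\mathbb{R}\setminus[-1,1]$, $c_M\circ H(1,\cdot)\circ c_N^{-1}(p,q)=(ap,0)$ for all $(p,q)\in[-1,1]\times\overline{\mathbb{B}}_{k-1}$. **h-sets with tails.** Let $\mathcal{X}=\mathbb{R}^k\times\mathcal{X}_2$ be a real Banach space. An h-set with tail is a pair $N=(N_1,|N_2|)$ with $N_1$ an h-set in $\mathbb{R}^k$ (head) and $|N_2|\subset\mathcal{X}_2$ closed, convex and bounded (tail); $|N|=|N_1|\times|N_2|$ and $c_N=(c_{N_1},\mathrm{Id})$. **Covering with tails.** For h-sets with tails $N,M$ in $\mathcal{X}$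 and a continuous compact map $F:|N|\to\mathcal{X}$, $N\overset{F}{\Longrightarrow}M$ means that there is a continuous compact homotopy $H:[0,1]\times|N|\to\mathcal{X}$ with: (C0) $H(t,|N|)\subset\mathbb{R}^k\times|M_2|$ for all $t$; (C1) $H(0,\cdot)=F$; (C2) $H([0,1],N_1^-\times|N_2|)\cap|M|=\varnothing$; (C3) $H([0,1],|N|)\cap(M_1^+\times|M_2|)=\varnothing$; (C4) there are $a\in\mathbb{R}\setminus[-1,1]$ and $\bar r\in|M_2|$ with $c_M\circ H(1,\cdot)\circ c_N^{-1}(p,q,r)=(ap,0,\bar r)$ for all $(p,q,r)\in[-1,1]\times\overline{\mathbb{B}}_{k-1}\times|N_2|$. A map is compact if it sends bounded sets to relatively compact sets. *)

theory Defs
  imports "HOL-Analysis.Analysis"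
begin

text \<open>
  Conventions. The phase space is \<^typ>\<open>real^'d\<close>, and the coordinate space of a section is
  \<^typ>\<open>real \<times> (real^'m)\<close>; the two are linked by the assumption that the cardinality of
  \<^typ>\<open>'d\<close> is that of \<^typ>\<open>'m\<close> plus two. The maximum norm is \<^const>\<open>infnorm\<close>.
  The norms of the types are built from Euclidean norms; they are equivalent to the ones
  built from the maximum norm and are used only through the topology and the bounded sets
  they define.
\<close>

instance bcontfun :: (metric_space, banach) banach ..

type_synonym 'm coords = "real \<times> (real^'m)"

type_synonym 'd hist = "real \<Rightarrow>\<^sub>C (real^'d)"

text \<open>
  Continuous functions on the interval from \<^term>\<open>- \<tau>\<close> to 0 are represented by their
  extensions to the whole line that are constant on both sides of the interval. These form a
  closed subspace of the bounded continuous functions, and the supremum norm over the line is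
  the one over the interval.
\<close>

definition hist_space :: "real \<Rightarrow> 'd::finite hist set" where
  "hist_space \<tau> = {\<phi>. ext_cont (apply_bcontfun \<phi>) (- \<tau>) 0 = apply_bcontfun \<phi>}"

definition tail_space :: "real \<Rightarrow> 'd::finite hist set" where
  "tail_space \<tau> = {r \<in> hist_space \<tau>. apply_bcontfun r 0 = 0}"

definition lipschitz_tails :: "real \<Rightarrow> real \<Rightarrow> 'd::finite hist set" where
  "lipschitz_tails \<tau> L = {r \<in> tail_space \<tau>.
     \<forall>t1\<in>{- \<tau>..0}. \<forall>t2\<in>{- \<tau>..0}.
       infnorm (apply_bcontfun r t2 - apply_bcontfun r t1) \<le> L * \<bar>t2 - t1\<bar>}"

definition flow :: "(real^'d \<Rightarrow> real^'d) \<Rightarrow> real \<Rightarrow> real^'d \<Rightarrow> real^'d" where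
  "flow f t x =
     (THE u. u 0 = x \<and> (\<forall>s. (u has_vector_derivative f (u s)) (at s))) t"

definition dde_solution ::
  "(real^'d \<Rightarrow> real^'d) \<Rightarrow> (real^'d \<Rightarrow> real^'d) \<Rightarrow> real \<Rightarrow> real \<Rightarrow> 'd hist
     \<Rightarrow> (real \<Rightarrow> real^'d) \<Rightarrow> bool" where
  "dde_solution f g \<tau> \<epsilon> \<phi> u \<longleftrightarrow>
     continuous_on {- \<tau>..} u \<and>
     (\<forall>t\<in>{- \<tau>..0}. u t = apply_bcontfun \<phi> t) \<and>
     (\<forall>t\<ge>0. (u has_vector_derivative (f (u t) + \<epsilon> *\<^sub>R g (u (t - \<tau>)))) (at t within {0..}))"

text \<open>The choice only concerns the irrelevant values of the solution before \<^term>\<open>- \<tau>\<close>.\<close>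

definition dde_sol ::
  "(real^'d \<Rightarrow> real^'d) \<Rightarrow> (real^'d \<Rightarrow> real^'d) \<Rightarrow> real \<Rightarrow> real \<Rightarrow> 'd hist
     \<Rightarrow> real \<Rightarrow> real^'d" where
  "dde_sol f g \<tau> \<epsilon> \<phi> = (SOME u. dde_solution f g \<tau> \<epsilon> \<phi> u)"

definition dde_semiflow ::
  "(real^'d \<Rightarrow> real^'d) \<Rightarrow> (real^'d \<Rightarrow> real^'d) \<Rightarrow> real \<Rightarrow> real \<Rightarrow> real \<Rightarrow> 'd hist \<Rightarrow> 'd hist" where
  "dde_semiflow f g \<tau> \<epsilon> t \<phi> =
     Bcontfun (ext_cont (\<lambda>s. dde_sol f g \<tau> \<epsilon> \<phi> (t + s)) (- \<tau>) 0)"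

text \<open>For open sets in finite dimension this is the usual notion of a map of class \<^term>\<open>n\<close>.\<close>

primrec Ck_on :: "nat \<Rightarrow> 'a::euclidean_space set \<Rightarrow> ('a \<Rightarrow> 'b::euclidean_space) \<Rightarrow> bool" where
  "Ck_on 0 V F \<longleftrightarrow> continuous_on V F"
| "Ck_on (Suc n) V F \<longleftrightarrow> (\<forall>x\<in>V. F differentiable (at x)) \<and>
     (\<forall>v. Ck_on n V (\<lambda>x. frechet_derivative F (at x) v))"

definition smooth_on :: "'a::euclidean_space set \<Rightarrow> ('a \<Rightarrow> 'b::euclidean_space) \<Rightarrow> bool" where
  "smooth_on V F \<longleftrightarrow> (\<forall>n. Ck_on n V F)"

definition grad :: "(real^'d \<Rightarrow> real) \<Rightarrow> real^'d \<Rightarrow> real^'d" where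
  "grad F x = (\<chi> i. frechet_derivative F (at x) (axis i 1))"

text \<open>
  \<^term>\<open>\<kappa>\<close> is a diffeomorphism of the embedded submanifold \<^term>\<open>S\<close> onto the open set
  \<^term>\<open>V\<close>, with inverse \<^term>\<open>\<sigma>\<close>: smoothness of \<^term>\<open>\<kappa>\<close> on \<^term>\<open>S\<close> amounts to
  \<^term>\<open>\<sigma>\<close> being an immersion.
\<close>

definition coord_diffeo ::
  "(real^'d) set \<Rightarrow> 'm::finite coords set \<Rightarrow> (real^'d \<Rightarrow> 'm coords)
     \<Rightarrow> ('m coords \<Rightarrow> real^'d) \<Rightarrow> bool" where
  "coord_diffeo S V \<kappa> \<sigma> \<longleftrightarrow>
     open V \<and> homeomorphism S V \<kappa> \<sigma> \<and> smooth_on V \<sigma> \<and>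
     (\<forall>x\<in>V. inj (frechet_derivative \<sigma> (at x)))"

definition smooth_submanifold :: "'m::finite itself \<Rightarrow> (real^'d) set \<Rightarrow> bool" where
  "smooth_submanifold _ S \<longleftrightarrow>
     (\<forall>x\<in>S. \<exists>W V (\<kappa> :: real^'d \<Rightarrow> 'm coords) \<sigma>.
        open W \<and> x \<in> W \<and> coord_diffeo (S \<inter> W) V \<kappa> \<sigma>)"

definition flow_box :: "(real^'d \<Rightarrow> real^'d) \<Rightarrow> (real^'d) set \<Rightarrow> real \<Rightarrow> (real^'d) set" where
  "flow_box f S \<delta> = (\<lambda>(t, x). flow f t x) ` ({- \<delta><..<\<delta>} \<times> S)"

text \<open>
  The set \<^term>\<open>flow_box f S \<delta>\<close> is open by invariance of domain, so derivatives at its points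
  only depend on the values of \<^term>\<open>\<alpha>\<close> on it.
\<close>

definition is_section ::
  "'m::finite itself \<Rightarrow> (real^'d \<Rightarrow> real^'d) \<Rightarrow> (real^'d) set \<Rightarrow> real \<Rightarrow> (real^'d \<Rightarrow> real)
     \<Rightarrow> bool" where
  "is_section m f S \<delta> \<alpha> \<longleftrightarrow>
     smooth_submanifold m S \<and> \<delta> > 0 \<and> Ck_on 1 (flow_box f S \<delta>) \<alpha> \<and>
     (\<exists>h. homeomorphism ({- \<delta><..<\<delta>} \<times> S) (flow_box f S \<delta>) (\<lambda>(t, x). flow f t x) h) \<and>
     S = {u \<in> flow_box f S \<delta>. \<alpha> u = 0} \<and>
     (\<exists>a>0. \<forall>u\<in>flow_box f S \<delta>. grad \<alpha> u \<bullet> f u \<ge> a) \<and>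
     (\<forall>t\<in>{- \<delta><..<0}. \<forall>x\<in>S. \<alpha> (flow f t x) < 0) \<and>
     (\<forall>t\<in>{0<..<\<delta>}. \<forall>x\<in>S. \<alpha> (flow f t x) > 0)"

definition return_time :: "(real^'d \<Rightarrow> real^'d) \<Rightarrow> (real^'d) set \<Rightarrow> real^'d \<Rightarrow> real" where
  "return_time f S u = Inf {t. 0 < t \<and> flow f t u \<in> S}"

definition poincare_map :: "(real^'d \<Rightarrow> real^'d) \<Rightarrow> (real^'d) set \<Rightarrow> real^'d \<Rightarrow> real^'d" where
  "poincare_map f S u = flow f (return_time f S u) u"

definition is_dde_return_time ::
  "(real^'d \<Rightarrow> real^'d) \<Rightarrow> (real^'d \<Rightarrow> real^'d) \<Rightarrow> real \<Rightarrow> (real^'d) set \<Rightarrow> real \<Rightarrow> real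
     \<Rightarrow> 'd hist \<Rightarrow> real \<Rightarrow> bool" where
  "is_dde_return_time f g \<tau> S \<eta> \<epsilon> \<phi> t \<longleftrightarrow>
     t \<in> {return_time f S (apply_bcontfun \<phi> 0) - \<eta> .. return_time f S (apply_bcontfun \<phi> 0) + \<eta>} \<and>
     apply_bcontfun (dde_semiflow f g \<tau> \<epsilon> t \<phi>) 0 \<in> S"

definition dde_return_map ::
  "(real^'d \<Rightarrow> real^'d) \<Rightarrow> (real^'d \<Rightarrow> real^'d) \<Rightarrow> real \<Rightarrow> (real^'d) set \<Rightarrow> real \<Rightarrow> real
     \<Rightarrow> 'd hist \<Rightarrow> 'd hist" where
  "dde_return_map f g \<tau> S \<eta> \<epsilon> \<phi> =
     dde_semiflow f g \<tau> \<epsilon> (THE t. is_dde_return_time f g \<tau> S \<eta> \<epsilon> \<phi> t) \<phi>"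

definition to_coords ::
  "(real^'d \<Rightarrow> 'm::finite coords) \<Rightarrow> 'd hist \<Rightarrow> 'm coords \<times> 'd hist" where
  "to_coords \<kappa> \<phi> = (\<kappa> (apply_bcontfun \<phi> 0), \<phi> - const_bcontfun (apply_bcontfun \<phi> 0))"

definition of_coords ::
  "('m::finite coords \<Rightarrow> real^'d) \<Rightarrow> 'm coords \<times> 'd hist \<Rightarrow> 'd hist" where
  "of_coords \<sigma> z = const_bcontfun (\<sigma> (fst z)) + snd z"

text \<open>An h-set is the pair of its support and its coordinate homeomorphism.\<close>

type_synonym 'm hset =
  "'m coords set \<times> ('m coords \<Rightarrow> 'm coords)"

abbreviation supp :: "'m::finite hset \<Rightarrow> 'm coords set" where
  "supp N \<equiv> fst N"

abbreviation coord :: "'m::finite hset \<Rightarrow> 'm coords \<Rightarrow> 'm coords" where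
  "coord N \<equiv> snd N"

definition max_ball :: "(real^'m) set" where
  "max_ball = {q. infnorm q \<le> 1}"

definition max_sphere :: "(real^'m) set" where
  "max_sphere = {q. infnorm q = 1}"

definition is_hset :: "'m::finite hset \<Rightarrow> bool" where
  "is_hset N \<longleftrightarrow> compact (supp N) \<and> (\<exists>h. homeomorphism UNIV UNIV (coord N) h) \<and>
     coord N ` supp N = {-1..1} \<times> max_ball"

definition exit_set :: "'m::finite hset \<Rightarrow> 'm coords set" where
  "exit_set N = inv (coord N) ` ({-1, 1} \<times> max_ball)"

definition entry_set :: "'m::finite hset \<Rightarrow> 'm coords set" where
  "entry_set N = inv (coord N) ` ({-1..1} \<times> max_sphere)"

definition covers ::
  "'m::finite hset \<Rightarrow> ('m coords \<Rightarrow> 'm coords) \<Rightarrow> 'm hset \<Rightarrow> bool" where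
  "covers N F M \<longleftrightarrow>
     is_hset N \<and> is_hset M \<and> continuous_on (supp N) F \<and>
     (\<exists>H :: real \<Rightarrow> 'm coords \<Rightarrow> 'm coords.
        continuous_on ({0..1} \<times> supp N) (\<lambda>(t, x). H t x) \<and>
        (\<forall>x\<in>supp N. H 0 x = F x) \<and>
        (\<forall>t\<in>{0..1}. \<forall>x\<in>exit_set N. H t x \<notin> supp M) \<and>
        (\<forall>t\<in>{0..1}. \<forall>x\<in>supp N. H t x \<notin> entry_set M) \<and>
        (\<exists>a. a \<notin> {-1..1} \<and>
           (\<forall>p\<in>{-1..1}. \<forall>q\<in>max_ball.
              coord M (H 1 (inv (coord N) (p, q))) = (a * p, 0))))"

text \<open>
  For h-sets with tails the second factor is a closed subspace \<^term>\<open>X\<close> of a Banach space.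
\<close>

type_synonym ('m, 'x) tailed_hset = "'m hset \<times> 'x set"

abbreviation tsupp :: "('m::finite, 'x) tailed_hset \<Rightarrow> ('m coords \<times> 'x) set" where
  "tsupp N \<equiv> supp (fst N) \<times> snd N"

definition is_tailed_hset :: "'x::banach set \<Rightarrow> ('m::finite, 'x) tailed_hset \<Rightarrow> bool" where
  "is_tailed_hset X N \<longleftrightarrow> is_hset (fst N) \<and>
     snd N \<subseteq> X \<and> closed (snd N) \<and> convex (snd N) \<and> bounded (snd N)"

definition compact_map_on :: "'a::metric_space set \<Rightarrow> ('a \<Rightarrow> 'b::metric_space) \<Rightarrow> bool" where
  "compact_map_on D F \<longleftrightarrow> (\<forall>B\<subseteq>D. bounded B \<longrightarrow> compact (closure (F ` B)))"

definition tailed_covers ::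
  "'x::banach set \<Rightarrow> ('m::finite, 'x) tailed_hset
     \<Rightarrow> ('m coords \<times> 'x \<Rightarrow> 'm coords \<times> 'x)
     \<Rightarrow> ('m, 'x) tailed_hset \<Rightarrow> bool" where
  "tailed_covers X N F M \<longleftrightarrow>
     is_tailed_hset X N \<and> is_tailed_hset X M \<and>
     F ` tsupp N \<subseteq> UNIV \<times> X \<and> continuous_on (tsupp N) F \<and> compact_map_on (tsupp N) F \<and>
     (\<exists>H :: real \<Rightarrow> 'm coords \<times> 'x \<Rightarrow> 'm coords \<times> 'x.
        continuous_on ({0..1} \<times> tsupp N) (\<lambda>(t, z). H t z) \<and>
        compact_map_on ({0..1} \<times> tsupp N) (\<lambda>(t, z). H t z) \<and>
        (\<forall>t\<in>{0..1}. \<forall>z\<in>tsupp N. H t z \<in> UNIV \<times> snd M) \<and>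
        (\<forall>z\<in>tsupp N. H 0 z = F z) \<and>
        (\<forall>t\<in>{0..1}. \<forall>z\<in>exit_set (fst N) \<times> snd N. H t z \<notin> tsupp M) \<and>
        (\<forall>t\<in>{0..1}. \<forall>z\<in>tsupp N. H t z \<notin> entry_set (fst M) \<times> snd M) \<and>
        (\<exists>a. a \<notin> {-1..1} \<and> (\<exists>s\<in>snd M.
           \<forall>p\<in>{-1..1}. \<forall>q\<in>max_ball. \<forall>r\<in>snd N.
             map_prod (coord (fst M)) id (H 1 (inv (coord (fst N)) (p, q), r))
               = ((a * p, 0), s))))"

end

theory Submission
  imports Defs "HOL-Complex_Analysis.Great_Picard"
begin

text \<open>
  The Lipschitz tails form a compact set, by the theorem of Arzela and Ascoli. The solutions
  of the delay equation depend continuously on \<^term>\<open>\<epsilon>\<close> and on the history, and for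
  \<^term>\<open>\<epsilon> = 0\<close> they follow the flow of the ODE. In the time window around the return time of the
  flow, an orbit of the flow crosses the section transversally inside the open flow box.
  By compactness, the orbits of the delay equation do the same when \<^term>\<open>\<bar>\<epsilon>\<bar>\<close> is small:
  \<^term>\<open>\<alpha>\<close> increases strictly along them and changes sign, which gives a unique return time. The graph
  of the return time as a function of \<^term>\<open>\<epsilon>\<close> and the history is compact, so the return time is continuous.
  Hence the head of the return map is uniformly close to the Poincare map for small \<^term>\<open>\<epsilon>\<close>, and a
  covering relation survives a small perturbation of the head because its conditions
  separate disjoint compact sets.
\<close>

text \<open>In the maximum norm the solutions of the delay equation have speed at most
  \<open>Mf + \<bar>\<epsilon>\<bar> * Mg\<close>, so every segment of a solution is again Lipschitz
  with the constant of its initial tail. The return map therefore keeps the tails whatever the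
  return time is, even one shorter than the delay, and only the heads have to be compared with the
  Poincare map. Two obstacles shape the estimates. The space of histories is not locally compact, so
  uniformity in the history has to come from the tails; and the tails themselves change with
  \<open>\<epsilon>\<close>. Hence the analysis takes place on the fixed compact set of tails with
  constant \<open>Mf + Mg\<close>, which contains the other tails as soon as
  \<open>\<bar>\<epsilon>\<bar> \<le> 1\<close>, and is restricted to the smaller tails at the end.
  Times near the return are measured as offsets from the return time of the flow. Two returns of the
  flow are at least \<open>2 * \<delta>\<close> apart, so offsets up to
  \<open>\<eta> < \<delta>\<close> stay at positive times and inside the flow box.\<close>

section \<open>Exponential estimates and causal differential equations\<close>

text \<open>Comparison with the antiderivative \<open>c / K * exp (K * s)\<close>. The factor
  \<open>1 / K\<close> gained by integration is what makes the weighted norms contract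
  below.\<close>

lemma norm_diff_le_exp:
  fixes H :: "real \<Rightarrow> 'a::real_normed_vector"
  assumes "K > 0" "c \<ge> 0" "0 \<le> t" and "continuous_on {0..t} H"
    and "\<And>s. 0 < s \<Longrightarrow> s < t \<Longrightarrow> (H has_vector_derivative h s) (at s)"
    and "\<And>s. 0 < s \<Longrightarrow> s < t \<Longrightarrow> norm (h s) \<le> c * exp (K * s)"
  shows "norm (H t - H 0) \<le> c / K * exp (K * t)"
proof (cases "t = 0")
  case False
  have "norm (H t - H 0) \<le> c / K * exp (K * t) - c / K * exp (K * 0)"
  proof (rule differentiable_bound_general[where f' = h and \<phi>' = "\<lambda>s. c * exp (K * s)"])
    show "((\<lambda>s. c / K * exp (K * s)) has_vector_derivative c * exp (K * s)) (at s)" for s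
      using \<open>K > 0\<close> unfolding has_real_derivative_iff_has_vector_derivative[symmetric]
      by (auto intro!: derivative_eq_intros)
    show "continuous_on {0..t} (\<lambda>s. c / K * exp (K * s))"
      by (intro continuous_intros)
  qed (use assms(3) False in \<open>simp_all add: assms(4-6)\<close>)
  then show ?thesis
    using assms(1,2) by (smt (verit) divide_nonneg_pos exp_ge_zero mult_nonneg_nonneg)
qed (use assms in auto)

lemma norm_diff_le_exp_abs:
  fixes H :: "real \<Rightarrow> 'a::real_normed_vector"
  assumes "K > 0" "c \<ge> 0" and H: "\<And>s. (H has_vector_derivative h s) (at s)"
    and h: "\<And>s. norm (h s) \<le> c * exp (K * \<bar>s\<bar>)"
  shows "norm (H t - H 0) \<le> c / K * exp (K * \<bar>t\<bar>)"
proof -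
  have cont: "continuous_on A H" for A
    using H by (meson continuous_at_imp_continuous_on has_vector_derivative_continuous)
  show ?thesis
  proof (cases "t \<ge> 0")
    case True
    then show ?thesis
      using norm_diff_le_exp[OF assms(1,2) True cont H] h
      by (metis abs_of_nonneg abs_of_pos)
  next
    case False
    have "norm ((H \<circ> uminus) (- t) - (H \<circ> uminus) 0) \<le> c / K * exp (K * - t)"
    proof (rule norm_diff_le_exp[OF assms(1,2)])
      show "((H \<circ> uminus) has_vector_derivative (- 1) *\<^sub>R h (- s)) (at s)" for s
        by (rule vector_diff_chain_at) (auto intro!: derivative_eq_intros H)
      show "norm ((- 1) *\<^sub>R h (- s)) \<le> c * exp (K * s)" if "0 < s" for s
        using h[of "- s"] that by simp
      show "continuous_on {0..- t} (H \<circ> uminus)"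
        by (intro continuous_on_compose continuous_intros cont)
    qed (use False in auto)
    then show ?thesis
      using False by simp
  qed
qed

text \<open>
  Measuring \<^term>\<open>w\<close> in the norm with weight \<^term>\<open>exp (- (2 * L * t))\<close> turns the hypothesis
  into an inequality that bounds that norm by half of itself plus a constant.
\<close>

lemma gronwall_causal:
  fixes w :: "real \<Rightarrow> 'a::real_normed_vector"
  assumes "L > 0" "b \<ge> 0" and cont: "continuous_on {0..T} w"
    and deriv: "\<And>s. 0 < s \<Longrightarrow> s < T \<Longrightarrow> (w has_vector_derivative w' s) (at s)"
    and bound: "\<And>s m. 0 < s \<Longrightarrow> s < T \<Longrightarrow> \<forall>r\<in>{0..s}. norm (w r) \<le> m \<Longrightarrow> norm (w' s) \<le> L * m + b"
    and t: "t \<in> {0..T}"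
  shows "norm (w t) \<le> (2 * norm (w 0) + b / L) * exp (2 * L * t)"
proof -
  let ?n = "\<lambda>s. exp (- (2 * L * s)) * norm (w s)"
  have "compact {0..T}" "{0..T} \<noteq> {}" "continuous_on {0..T} ?n"
    using t cont by (auto intro!: continuous_intros)
  then obtain s0 where s0: "s0 \<in> {0..T}" and max: "\<And>s. s \<in> {0..T} \<Longrightarrow> ?n s \<le> ?n s0"
    using continuous_attains_sup[of "{0..T}" ?n] by blast
  define m where "m = ?n s0"
  have m0: "m \<ge> 0"
    by (simp add: m_def)
  have le: "norm (w s) \<le> m * exp (2 * L * s)" if "s \<in> {0..T}" for s
    using max[OF that] by (simp add: m_def exp_minus field_simps)
  have "norm (w s0 - w 0) \<le> (L * m + b) / (2 * L) * exp (2 * L * s0)"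
  proof (rule norm_diff_le_exp[where h = w'])
    show "norm (w' s) \<le> (L * m + b) * exp (2 * L * s)" if s: "0 < s" "s < s0" for s
    proof -
      \<comment> \<open>The weight grows with time, so the value at \<open>s\<close> bounds
        \<open>w\<close> on the whole past \<open>{0..s}\<close>, as the causal hypothesis
        \<open>bound\<close> asks.\<close>
      have "norm (w r) \<le> m * exp (2 * L * s)" if r: "r \<in> {0..s}" for r
      proof -
        have "norm (w r) \<le> m * exp (2 * L * r)"
          using r s s0 by (intro le) auto
        also have "\<dots> \<le> m * exp (2 * L * s)"
          using r m0 \<open>L > 0\<close> by (intro mult_left_mono) auto
        finally show ?thesis .
      qed
      then have "norm (w' s) \<le> L * (m * exp (2 * L * s)) + b"
        using s s0 by (intro bound) auto
      also have "b \<le> b * exp (2 * L * s)"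
        using \<open>b \<ge> 0\<close> \<open>L > 0\<close> s by (simp add: mult_le_cancel_left1)
      finally show ?thesis
        by (simp add: algebra_simps)
    qed
  qed (use assms s0 m0 in \<open>auto intro: continuous_on_subset\<close>)
  moreover have "norm (w s0) = m * exp (2 * L * s0)"
    by (simp add: m_def exp_minus field_simps)
  moreover have "norm (w 0) \<le> norm (w 0) * exp (2 * L * s0)"
    using \<open>L > 0\<close> s0 by (simp add: mult_le_cancel_left1)
  ultimately have "m * exp (2 * L * s0) \<le> (norm (w 0) + (L * m + b) / (2 * L)) * exp (2 * L * s0)"
    using norm_triangle_sub[of "w s0" "w 0"] by (simp add: algebra_simps)
  \<comment> \<open>With growth rate \<open>2 * L\<close> the term \<open>L * m / (2 * L)\<close> is
    \<open>m / 2\<close>. Absorbing it on the left doubles the rest and gives the constants of the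
    statement.\<close>
  then have "m \<le> norm (w 0) + (L * m + b) / (2 * L)"
    by simp
  then have "m \<le> 2 * norm (w 0) + b / L"
    using \<open>L > 0\<close> by (simp add: field_simps)
  then show ?thesis
    using le[OF t] by (meson exp_ge_zero mult_right_mono order_trans)
qed

lemma norm_exp_minus_scaleR_le:
  fixes z :: "'a::real_normed_vector"
  assumes "norm z \<le> c * exp y"
  shows "norm (exp (- y) *\<^sub>R z) \<le> c"
  using assms by (simp add: exp_minus inverse_eq_divide pos_divide_le_eq)

text \<open>
  Banach's fixed point theorem for the supremum norm with weight \<^term>\<open>exp (- (2 * L * \<bar>t\<bar>))\<close>.
  The operator \<^term>\<open>\<Theta>\<close> may depend on the past of \<^term>\<open>u\<close>, which covers the ODE in both time
  directions and the delay equation at once.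
\<close>

lemma causal_ode_exists:
  fixes \<Theta> :: "(real \<Rightarrow> 'a::euclidean_space) \<Rightarrow> real \<Rightarrow> 'a"
  assumes "L > 0"
    and cont: "\<And>u. continuous_on UNIV u \<Longrightarrow> continuous_on UNIV (\<Theta> u)"
    and bdd: "\<And>u s. norm (\<Theta> u s) \<le> B"
    and lip: "\<And>u v s m. \<forall>r. \<bar>r\<bar> \<le> \<bar>s\<bar> \<longrightarrow> norm (u r - v r) \<le> m
      \<Longrightarrow> norm (\<Theta> u s - \<Theta> v s) \<le> L * m"
  obtains u where "u 0 = x" "\<And>t. (u has_vector_derivative \<Theta> u t) (at t)"
proof -
  define K where "K = 2 * L"
  have "K > 0"
    using \<open>L > 0\<close> by (simp add: K_def)
  have "B \<ge> 0"
    using bdd norm_ge_zero order_trans by blast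
  have "\<exists>A. A 0 = 0 \<and> (\<forall>t. (A has_vector_derivative h t) (at t))"
    if h: "continuous_on UNIV h" for h :: "real \<Rightarrow> 'a"
  proof -
    have "isCont h t" for t
      using h continuous_on_eq_continuous_at by blast
    then obtain F where "\<And>t. (F has_vector_derivative h t) (at t)"
      using einterval_antiderivative[of "-\<infinity>" "\<infinity>" h] by auto
    then have "\<forall>t. ((\<lambda>t. F t - F 0) has_vector_derivative h t) (at t)"
      by (auto intro!: derivative_eq_intros)
    then show ?thesis
      by (intro exI[of _ "\<lambda>t. F t - F 0"]) simp
  qed
  \<comment> \<open>\<open>A\<close> selects antiderivatives that vanish at 0; they serve as the
    integral from 0 to \<open>t\<close> for both signs of \<open>t\<close>.\<close>
  then have "\<forall>h\<in>Collect (continuous_on UNIV). \<exists>A. A 0 = 0 \<and>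
      (\<forall>t. (A has_vector_derivative (h :: real \<Rightarrow> 'a) t) (at t))"
    by simp
  from bchoice[OF this] obtain A where A: "\<And>h :: real \<Rightarrow> 'a. continuous_on UNIV h \<Longrightarrow>
      A h 0 = 0 \<and> (\<forall>t. (A h has_vector_derivative h t) (at t))"
    by auto
  \<comment> \<open>\<open>E\<close> multiplies by the growing weight and \<open>G\<close> divides
    by it again, so the fixed point is sought in the complete space of bounded continuous functions
    although solutions may be unbounded.\<close>
  define E where "E = (\<lambda>(v :: real \<Rightarrow>\<^sub>C 'a) t. exp (K * \<bar>t\<bar>) *\<^sub>R apply_bcontfun v t)"
  have contE: "continuous_on UNIV (\<Theta> (E v))" for v
    unfolding E_def by (intro cont continuous_intros) simp
  define J where "J v = A (\<Theta> (E v))" for v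
  have J0: "J v 0 = 0" and J: "(J v has_vector_derivative \<Theta> (E v) t) (at t)" for v t
    using A[OF contE] by (auto simp: J_def)
  have contJ: "continuous_on UNIV (J v)" for v
    using J by (meson continuous_at_imp_continuous_on has_vector_derivative_continuous)
  define G where "G v = Bcontfun (\<lambda>t. exp (- (K * \<bar>t\<bar>)) *\<^sub>R (x + J v t))" for v
  have G: "apply_bcontfun (G v) t = exp (- (K * \<bar>t\<bar>)) *\<^sub>R (x + J v t)" for v t
  proof -
    \<comment> \<open>The bound on \<open>\<Theta>\<close> enters here: \<open>J v\<close> stays
      within the growth that the weight allows, so \<open>G v\<close> is bounded.\<close>
    have "norm (J v t) \<le> B / K * exp (K * \<bar>t\<bar>)" for t
    proof -
      have "norm (\<Theta> (E v) s) \<le> B * exp (K * \<bar>s\<bar>)" for s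
      proof -
        have "B \<le> B * exp (K * \<bar>s\<bar>)"
          using \<open>B \<ge> 0\<close> \<open>K > 0\<close> by (simp add: mult_le_cancel_left1)
        then show ?thesis
          using bdd order_trans by blast
      qed
      then show ?thesis
        using norm_diff_le_exp_abs[OF \<open>K > 0\<close> \<open>B \<ge> 0\<close> J] J0 by simp
    qed
    moreover have "norm x \<le> norm x * exp (K * \<bar>t\<bar>)" for t
      using \<open>K > 0\<close> by (simp add: mult_le_cancel_left1)
    ultimately have "norm x + norm (J v t) \<le> norm x * exp (K * \<bar>t\<bar>) + B / K * exp (K * \<bar>t\<bar>)" for t
      by (rule add_mono[rotated])
    then have "norm (x + J v t) \<le> (norm x + B / K) * exp (K * \<bar>t\<bar>)" for t
      unfolding distrib_right using norm_triangle_ineq order_trans by blast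
    then have "norm (exp (- (K * \<bar>t\<bar>)) *\<^sub>R (x + J v t)) \<le> norm x + B / K" for t
      by (rule norm_exp_minus_scaleR_le)
    then have "bounded (range (\<lambda>t. exp (- (K * \<bar>t\<bar>)) *\<^sub>R (x + J v t)))"
      by (auto simp: bounded_iff)
    moreover have "continuous_on UNIV (\<lambda>t. exp (- (K * \<bar>t\<bar>)) *\<^sub>R (x + J v t))"
      by (intro continuous_intros contJ)
    ultimately have "(\<lambda>t. exp (- (K * \<bar>t\<bar>)) *\<^sub>R (x + J v t)) \<in> bcontfun"
      by (simp add: bcontfun_def)
    then show ?thesis
      unfolding G_def by (simp add: Bcontfun_inverse)
  qed
  \<comment> \<open>The contraction factor is the Lipschitz constant \<open>L\<close> times the gain
    \<open>1 / K = 1 / (2 * L)\<close>.\<close>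
  have "dist (G v) (G w) \<le> 1 / 2 * dist v w" for v w
  proof (rule dist_bound)
    fix t
    have "norm ((J v t - J w t) - (J v 0 - J w 0)) \<le> (L * dist v w) / K * exp (K * \<bar>t\<bar>)"
    proof (rule norm_diff_le_exp_abs[OF \<open>K > 0\<close>, of _ "\<lambda>t. J v t - J w t"])
      show "((\<lambda>t. J v t - J w t) has_vector_derivative \<Theta> (E v) s - \<Theta> (E w) s) (at s)" for s
        by (intro derivative_intros J)
      show "norm (\<Theta> (E v) s - \<Theta> (E w) s) \<le> L * dist v w * exp (K * \<bar>s\<bar>)" for s
      proof -
        have "norm (E v r - E w r) \<le> dist v w * exp (K * \<bar>s\<bar>)" if "\<bar>r\<bar> \<le> \<bar>s\<bar>" for r
        proof -
          have "norm (E v r - E w r) = exp (K * \<bar>r\<bar>) * dist (apply_bcontfun v r) (apply_bcontfun w r)"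
            by (simp add: E_def dist_norm flip: scaleR_diff_right)
          also have "\<dots> \<le> exp (K * \<bar>s\<bar>) * dist v w"
            using that \<open>K > 0\<close> by (intro mult_mono dist_bounded) auto
          finally show ?thesis
            by (simp add: mult.commute)
        qed
        then have "norm (\<Theta> (E v) s - \<Theta> (E w) s) \<le> L * (dist v w * exp (K * \<bar>s\<bar>))"
          by (intro lip) auto
        then show ?thesis
          by (simp add: mult.assoc)
      qed
    qed (use \<open>L > 0\<close> in simp)
    then have "norm (J v t - J w t) \<le> 1 / 2 * dist v w * exp (K * \<bar>t\<bar>)"
      using \<open>L > 0\<close> by (simp add: J0 K_def)
    then have "norm (exp (- (K * \<bar>t\<bar>)) *\<^sub>R (J v t - J w t)) \<le> 1 / 2 * dist v w"
      by (rule norm_exp_minus_scaleR_le)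
    moreover have "apply_bcontfun (G v) t - apply_bcontfun (G w) t
        = exp (- (K * \<bar>t\<bar>)) *\<^sub>R (J v t - J w t)"
      by (simp add: G algebra_simps)
    ultimately show "dist (apply_bcontfun (G v) t) (apply_bcontfun (G w) t) \<le> 1 / 2 * dist v w"
      by (simp add: dist_norm)
  qed
  then have "\<exists>!v. G v = v"
    by (intro banach_fix_type[where c = "1 / 2"]) auto
  then obtain v where v: "G v = v"
    by blast
  have u: "E v t = x + J v t" for t
    unfolding E_def by (subst v[symmetric]) (simp add: G exp_minus)
  show ?thesis
  proof (rule that[of "E v"])
    show "E v 0 = x"
      by (simp add: u J0)
    have "(\<lambda>t. x + J v t) = E v"
      by (simp add: u fun_eq_iff)
    moreover have "((\<lambda>t. x + J v t) has_vector_derivative \<Theta> (E v) t) (at t)" for t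
      using J by (auto intro!: derivative_eq_intros)
    ultimately show "(E v has_vector_derivative \<Theta> (E v) t) (at t)" for t
      by simp
  qed
qed

lemma infnorm_le_iff: "infnorm x \<le> c \<longleftrightarrow> (\<forall>i\<in>Basis. \<bar>x \<bullet> i\<bar> \<le> c)"
  for x :: "'a::euclidean_space"
  by (simp add: infnorm_Max)

text \<open>The mean value inequality is applied to each coordinate, which loses no factor in the
  maximum norm. A detour through the Euclidean norm would spoil the exact constant of the
  tails.\<close>

lemma infnorm_diff_le_of_derivative:
  fixes u :: "real \<Rightarrow> 'a::euclidean_space"
  assumes "a \<le> b" "continuous_on {a..b} u"
    and deriv: "\<And>s. a < s \<Longrightarrow> s < b \<Longrightarrow> (u has_vector_derivative u' s) (at s)"
    and bound: "\<And>s. a < s \<Longrightarrow> s < b \<Longrightarrow> infnorm (u' s) \<le> M"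
  shows "infnorm (u b - u a) \<le> M * (b - a)"
proof (cases "a = b")
  case False
  then have "a < b"
    using \<open>a \<le> b\<close> by simp
  have "\<bar>(u b - u a) \<bullet> i\<bar> \<le> M * (b - a)" if i: "i \<in> Basis" for i
  proof -
    have "norm (u b \<bullet> i - u a \<bullet> i) \<le> M * b - M * a"
    proof (rule differentiable_bound_general[OF \<open>a < b\<close>,
        where f' = "\<lambda>s. u' s \<bullet> i" and \<phi>' = "\<lambda>_. M"])
      show "((\<lambda>s. u s \<bullet> i) has_vector_derivative u' s \<bullet> i) (at s)" if "a < s" "s < b" for s
        using bounded_linear.has_vector_derivative[OF bounded_linear_inner_left deriv[OF that]] .
      show "norm (u' s \<bullet> i) \<le> M" if "a < s" "s < b" for s
        using bound[OF that] i by (simp add: infnorm_le_iff)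
      show "((*) M has_vector_derivative M) (at s)" for s
        unfolding has_real_derivative_iff_has_vector_derivative[symmetric]
        by (auto intro!: derivative_eq_intros)
    qed (use assms in \<open>auto intro!: continuous_intros\<close>)
    then show ?thesis
      by (simp add: inner_diff_left right_diff_distrib)
  qed
  then show ?thesis
    by (simp add: infnorm_le_iff)
qed (simp add: infnorm_0)

subsection \<open>Lipschitz tails\<close>

lemma clamp_real_mem: "a \<le> b \<Longrightarrow> clamp a b x \<in> {a..b}" for a b x :: real
  using clamp_in_interval[of a b x] by simp

lemma clamp_real_eq: "x \<in> {a..b} \<Longrightarrow> clamp a b x = x" for a b x :: real
  by (simp add: clamp_def)

lemma apply_Bcontfun_ext_cont:
  fixes u :: "real \<Rightarrow> 'a::metric_space"
  assumes "continuous_on {a..b} u"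
  shows "apply_bcontfun (Bcontfun (ext_cont u a b)) s = u (clamp a b s)"
proof -
  obtain h :: "real \<Rightarrow>\<^sub>C 'a" where "\<And>s. apply_bcontfun h s = u (clamp a b s)"
    using continuous_on_cbox_bcontfunE[of a b u] assms by auto
  then have "ext_cont u a b = apply_bcontfun h" "apply_bcontfun h s = u (clamp a b s)"
    by (auto simp: ext_cont_def)
  then show ?thesis
    by (simp add: apply_bcontfun_inverse)
qed

lemma continuous_on_apply_bcontfun_left: "continuous_on A (\<lambda>r. apply_bcontfun r s)"
  unfolding continuous_on_iff using dist_bounded le_less_trans by blast

lemma hist_space_iff: "r \<in> hist_space \<tau> \<longleftrightarrow> (\<forall>s. apply_bcontfun r (clamp (- \<tau>) 0 s) = apply_bcontfun r s)"
  by (simp add: hist_space_def ext_cont_def fun_eq_iff)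

lemma hist_space_Bcontfun:
  assumes "\<tau> \<ge> 0" "continuous_on {- \<tau>..0} u"
  shows "Bcontfun (ext_cont u (- \<tau>) 0) \<in> hist_space \<tau>"
  using assms clamp_real_eq[OF clamp_real_mem[of "- \<tau>" 0]]
  by (simp add: hist_space_iff apply_Bcontfun_ext_cont)

lemma dist_hist_le:
  assumes "\<tau> \<ge> 0" "r \<in> hist_space \<tau>" "q \<in> hist_space \<tau>"
    and "\<And>s. s \<in> {- \<tau>..0} \<Longrightarrow> dist (apply_bcontfun r s) (apply_bcontfun q s) \<le> c"
  shows "dist r q \<le> c"
proof (rule dist_bound)
  fix s
  show "dist (apply_bcontfun r s) (apply_bcontfun q s) \<le> c"
    using assms(4)[OF clamp_real_mem[of "- \<tau>" 0 s]] assms(1-3) by (simp add: hist_space_iff)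
qed

lemma zero_in_lipschitz_tails: "L \<ge> 0 \<Longrightarrow> 0 \<in> lipschitz_tails \<tau> L"
  by (simp add: lipschitz_tails_def tail_space_def hist_space_iff infnorm_0)

lemma lipschitz_tails_mono: "L \<le> L' \<Longrightarrow> lipschitz_tails \<tau> L \<subseteq> lipschitz_tails \<tau> L'"
  unfolding lipschitz_tails_def by (smt (verit, best) Collect_mono abs_ge_zero mult_right_mono)

lemma convex_lipschitz_tails: "convex (lipschitz_tails \<tau> L)"
proof (rule convexI)
  fix r q :: "'a hist" and a b :: real
  assume r: "r \<in> lipschitz_tails \<tau> L" and q: "q \<in> lipschitz_tails \<tau> L"
    and ab: "0 \<le> a" "0 \<le> b" "a + b = 1"
  have "infnorm (apply_bcontfun (a *\<^sub>R r + b *\<^sub>R q) t - apply_bcontfun (a *\<^sub>R r + b *\<^sub>R q) s)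
      \<le> L * \<bar>t - s\<bar>"
    if "t \<in> {- \<tau>..0}" "s \<in> {- \<tau>..0}" for s t
  proof -
    have "infnorm (a *\<^sub>R (apply_bcontfun r t - apply_bcontfun r s) +
        b *\<^sub>R (apply_bcontfun q t - apply_bcontfun q s))
        \<le> a * infnorm (apply_bcontfun r t - apply_bcontfun r s) +
          b * infnorm (apply_bcontfun q t - apply_bcontfun q s)"
      using infnorm_triangle ab by (metis abs_of_nonneg infnorm_mul)
    also have "\<dots> \<le> a * (L * \<bar>t - s\<bar>) + b * (L * \<bar>t - s\<bar>)"
      using r q that ab by (intro add_mono mult_left_mono) (auto simp: lipschitz_tails_def)
    also have "\<dots> = L * \<bar>t - s\<bar>"
      using ab by (simp flip: distrib_right)
    finally show ?thesis
      by (simp add: algebra_simps)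
  qed
  then show "a *\<^sub>R r + b *\<^sub>R q \<in> lipschitz_tails \<tau> L"
    using r q by (auto simp: lipschitz_tails_def tail_space_def hist_space_iff)
qed

lemma closed_lipschitz_tails: "closed (lipschitz_tails \<tau> L :: 'd::finite hist set)"
proof -
  have "(lipschitz_tails \<tau> L :: 'd hist set) =
      {r. \<forall>s. apply_bcontfun r (clamp (- \<tau>) 0 s) = apply_bcontfun r s} \<inter>
      {r. apply_bcontfun r 0 = 0} \<inter>
      (\<Inter>t\<in>{- \<tau>..0}. \<Inter>s\<in>{- \<tau>..0}.
        {r. infnorm (apply_bcontfun r s - apply_bcontfun r t) \<le> L * \<bar>s - t\<bar>})"
    by (auto simp: lipschitz_tails_def tail_space_def hist_space_iff)
  then show ?thesis
    by (simp only:) (intro closed_Int closed_Collect_all closed_Collect_eq closed_INT ballI closed_Collect_le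
        continuous_intros continuous_on_apply_bcontfun_left)
qed

text \<open>A tail vanishes at 0, so the common Lipschitz constant gives the uniform bound as well
  as the equicontinuity. The factor \<open>?c\<close> converts the maximum norm to the Euclidean
  one.\<close>

lemma compact_lipschitz_tails:
  assumes "\<tau> \<ge> 0" "L \<ge> 0"
  shows "compact (lipschitz_tails \<tau> L :: 'd::finite hist set)"
proof -
  let ?c = "sqrt (real DIM(real^'d))"
  have lip: "norm (apply_bcontfun r t - apply_bcontfun r s) \<le> ?c * L * \<bar>t - s\<bar>"
    if "r \<in> lipschitz_tails \<tau> L" "s \<in> {- \<tau>..0}" "t \<in> {- \<tau>..0}" for r :: "'d hist" and s t
  proof -
    have "infnorm (apply_bcontfun r t - apply_bcontfun r s) \<le> L * \<bar>t - s\<bar>"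
      using that by (auto simp: lipschitz_tails_def)
    then show ?thesis
      using norm_le_infnorm[of "apply_bcontfun r t - apply_bcontfun r s"]
      by (smt (verit, best) mult.assoc mult_left_mono real_sqrt_ge_zero of_nat_0_le_iff)
  qed
  have "seq_compact (lipschitz_tails \<tau> L :: 'd hist set)"
  proof (rule seq_compactI)
    fix r :: "nat \<Rightarrow> 'd hist"
    assume r: "\<forall>n. r n \<in> lipschitz_tails \<tau> L"
    then have r': "r n \<in> hist_space \<tau>" for n
      by (simp add: lipschitz_tails_def tail_space_def)
    obtain g and k :: "nat \<Rightarrow> nat" where g: "continuous_on {- \<tau>..0} g" and k: "strict_mono k"
      and lim: "\<And>e. 0 < e \<Longrightarrow>
        \<exists>N. \<forall>n s. n \<ge> N \<and> s \<in> {- \<tau>..0} \<longrightarrow> norm (apply_bcontfun (r (k n)) s - g s) < e"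
    proof (rule Arzela_Ascoli[of "{- \<tau>..0}" "\<lambda>n. apply_bcontfun (r n)" "?c * L * \<tau>"])
      show "norm (apply_bcontfun (r n) s) \<le> ?c * L * \<tau>" if s: "s \<in> {- \<tau>..0}" for n s
      proof -
        have "apply_bcontfun (r n) 0 = 0"
          using r by (simp add: lipschitz_tails_def tail_space_def)
        then have "norm (apply_bcontfun (r n) s) \<le> ?c * L * \<bar>s\<bar>"
          using lip[OF r[rule_format], of 0 s n] s assms by simp
        also have "\<dots> \<le> ?c * L * \<tau>"
          using s assms by (intro mult_left_mono) auto
        finally show ?thesis .
      qed
      show "\<exists>d>0. \<forall>n y. y \<in> {- \<tau>..0} \<and> norm (x - y) < d \<longrightarrow>
          norm (apply_bcontfun (r n) x - apply_bcontfun (r n) y) < e"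
        if x: "x \<in> {- \<tau>..0}" and e: "0 < e" for x e
      proof (intro exI conjI allI impI)
        \<comment> \<open>The added 1 keeps the denominator positive when
          \<open>L = 0\<close>.\<close>
        show "0 < e / (?c * L + 1)"
          using e assms by (intro divide_pos_pos add_nonneg_pos mult_nonneg_nonneg) auto
        fix n y assume y: "y \<in> {- \<tau>..0} \<and> norm (x - y) < e / (?c * L + 1)"
        have pos: "?c * L + 1 > 0"
          using assms by (intro add_nonneg_pos mult_nonneg_nonneg) auto
        have "norm (apply_bcontfun (r n) x - apply_bcontfun (r n) y) \<le> ?c * L * \<bar>x - y\<bar>"
          using lip[OF r[rule_format]] x y by blast
        also have "\<dots> \<le> (?c * L + 1) * \<bar>x - y\<bar>"
          by (intro mult_right_mono) auto
        also have "\<dots> < e"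
          using y pos by (simp add: pos_less_divide_eq mult.commute)
        finally show "norm (apply_bcontfun (r n) x - apply_bcontfun (r n) y) < e" .
      qed
    qed auto
    \<comment> \<open>The limit is known on the interval only. Its constant extension is a history,
      and uniform convergence on the interval becomes convergence in the space.\<close>
    define l where "l = Bcontfun (ext_cont g (- \<tau>) 0)"
    have l: "l \<in> hist_space \<tau>"
      unfolding l_def using assms g by (intro hist_space_Bcontfun)
    have lg: "apply_bcontfun l s = g s" if "s \<in> {- \<tau>..0}" for s
      using g that by (simp add: l_def apply_Bcontfun_ext_cont clamp_real_eq)
    have "(\<lambda>n. r (k n)) \<longlonglongrightarrow> l"
    proof (rule metric_LIMSEQ_I)
      fix e :: real assume "e > 0"
      then obtain N where N: "\<forall>n s. n \<ge> N \<and> s \<in> {- \<tau>..0} \<longrightarrow>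
          norm (apply_bcontfun (r (k n)) s - g s) < e / 2"
        using lim[of "e / 2"] by auto
      have "dist (r (k n)) l \<le> e / 2" if "n \<ge> N" for n
        by (rule dist_hist_le[OF assms(1) r' l]) (use N that lg in \<open>auto simp: dist_norm less_imp_le\<close>)
      then show "\<exists>N. \<forall>n\<ge>N. dist (r (k n)) l < e"
        using \<open>e > 0\<close> by (metis field_sum_of_halves less_add_same_cancel1 half_gt_zero order_le_less_trans)
    qed
    moreover from this have "l \<in> lipschitz_tails \<tau> L"
      using r closed_lipschitz_tails closed_sequentially by meson
    ultimately show "\<exists>l\<in>lipschitz_tails \<tau> L. \<exists>k. strict_mono k \<and> (r \<circ> k) \<longlonglongrightarrow> l"
      using k by (auto simp: o_def)
  qed
  then show ?thesis
    by (simp add: compact_eq_seq_compact_metric)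
qed

subsection \<open>The flow\<close>

locale dde_data =
  fixes f g :: "real^'d \<Rightarrow> real^'d" and \<tau> Mf Mg Lf Lg :: real
  assumes pos: "\<tau> > 0" "Mf > 0" "Mg > 0" "Lf > 0" "Lg > 0"
    and bound: "infnorm (f u) \<le> Mf" "infnorm (g u) \<le> Mg"
    and lipschitz: "infnorm (f u - f v) \<le> Lf * infnorm (u - v)"
      "infnorm (g u - g v) \<le> Lg * infnorm (u - v)"
begin

text \<open>One Lipschitz constant \<open>L\<close> and one bound \<open>B\<close> serve both fields
  in the Euclidean norm of the type. The factor lost in the conversion is harmless, because
  \<open>L\<close> and \<open>B\<close> never enter the constant of the tails.\<close>

definition "rootd = sqrt (real CARD('d))"
definition "L = rootd * (Lf + Lg)"
definition "B = rootd * (Mf + Mg)"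

lemma rootd_pos: "rootd > 0"
  by (simp add: rootd_def)

lemma norm_le_rootd_infnorm: "norm x \<le> rootd * infnorm x" for x :: "real^'d"
  using norm_le_infnorm[of x] by (simp add: rootd_def)

lemma L_pos: "L > 0" and B_pos: "B > 0"
  using pos rootd_pos by (simp_all add: L_def B_def)

lemma norm_bound: "norm (f u) \<le> B" "norm (g u) \<le> B"
proof -
  have "norm x \<le> B" if "infnorm x \<le> Mf + Mg" for x :: "real^'d"
    unfolding B_def using norm_le_rootd_infnorm[of x] mult_left_mono[OF that, of rootd] rootd_pos
    by linarith
  then show "norm (f u) \<le> B" "norm (g u) \<le> B"
    using bound[of u] pos by auto
qed

lemma norm_lipschitz: "norm (f u - f v) \<le> L * norm (u - v)" "norm (g u - g v) \<le> L * norm (u - v)"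
proof -
  have *: "norm x \<le> L * norm y" if "infnorm x \<le> l * infnorm y" "0 < l" "l \<le> Lf + Lg"
    for x y :: "real^'d" and l
  proof -
    have "infnorm x \<le> (Lf + Lg) * norm y"
      using that mult_mono[OF that(3) infnorm_le_norm[of y]] pos by (simp add: infnorm_pos_le)
    then have "rootd * infnorm x \<le> rootd * ((Lf + Lg) * norm y)"
      using rootd_pos by (intro mult_left_mono) auto
    then show ?thesis
      using norm_le_rootd_infnorm[of x] by (simp add: L_def mult.assoc)
  qed
  show "norm (f u - f v) \<le> L * norm (u - v)" "norm (g u - g v) \<le> L * norm (u - v)"
    by (rule *[OF lipschitz(1)] *[OF lipschitz(2)], use pos in auto)+
qed

lemma norm_lipschitz_le:
  "norm (u - v) \<le> m \<Longrightarrow> norm (f u - f v) \<le> L * m"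
  "norm (u - v) \<le> m \<Longrightarrow> norm (g u - g v) \<le> L * m"
  using norm_lipschitz[of u v] mult_left_mono[of "norm (u - v)" m L] L_pos by linarith+

lemma continuous_fields: "continuous_on A f" "continuous_on A g"
proof -
  have "L-lipschitz_on A f" "L-lipschitz_on A g"
    using norm_lipschitz L_pos by (auto intro!: lipschitz_onI simp: dist_norm)
  then show "continuous_on A f" "continuous_on A g"
    using lipschitz_on_continuous_on by blast+
qed

text \<open>Gronwall with equal initial values and \<open>b = 0\<close>. The factor \<open>c\<close>
  is there for the choice \<open>c = - 1\<close>, which is the equation with time reversed.\<close>

lemma ode_unique_forward:
  assumes "u 0 = v 0" "\<And>s. (u has_vector_derivative c *\<^sub>R f (u s)) (at s)"
    "\<And>s. (v has_vector_derivative c *\<^sub>R f (v s)) (at s)" "\<bar>c\<bar> \<le> 1" "0 \<le> t"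
  shows "u t = v t"
proof -
  have "norm (u t - v t) \<le> (2 * norm (u 0 - v 0) + 0 / L) * exp (2 * L * t)"
  proof (rule gronwall_causal[where T = t and w = "\<lambda>t. u t - v t"])
    show deriv: "((\<lambda>t. u t - v t) has_vector_derivative c *\<^sub>R f (u s) - c *\<^sub>R f (v s)) (at s)" for s
      by (intro derivative_intros assms)
    show "continuous_on {0..t} (\<lambda>t. u t - v t)"
      using deriv by (meson continuous_at_imp_continuous_on has_vector_derivative_continuous)
    show "norm (c *\<^sub>R f (u s) - c *\<^sub>R f (v s)) \<le> L * m + 0"
      if "0 < s" "\<forall>r\<in>{0..s}. norm (u r - v r) \<le> m" for s m
    proof -
      have "norm (c *\<^sub>R f (u s) - c *\<^sub>R f (v s)) \<le> norm (f (u s) - f (v s))"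
        using \<open>\<bar>c\<bar> \<le> 1\<close> by (simp add: mult_left_le_one_le flip: scaleR_diff_right)
      also have "\<dots> \<le> L * m"
        using that by (intro norm_lipschitz_le) auto
      finally show ?thesis
        by simp
    qed
  qed (use assms L_pos in auto)
  then show ?thesis
    using assms(1) by simp
qed

lemma ode_unique:
  assumes "u 0 = v 0" and u: "\<And>s. (u has_vector_derivative f (u s)) (at s)"
    and v: "\<And>s. (v has_vector_derivative f (v s)) (at s)"
  shows "u = v"
proof
  fix t :: real
  show "u t = v t"
  proof (cases "t \<ge> 0")
    case True
    then show ?thesis
      using ode_unique_forward[of u v 1 t] assms by simp
  next
    case False
    have rev: "((\<lambda>s. w (- s)) has_vector_derivative (- 1) *\<^sub>R f (w (- s))) (at s)"
      if "\<And>s. (w has_vector_derivative f (w s)) (at s)" for w s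
    proof -
      have "((w \<circ> uminus) has_vector_derivative (- 1) *\<^sub>R f (w (- s))) (at s)"
        by (rule vector_diff_chain_at) (auto intro!: derivative_eq_intros that)
      then show ?thesis
        by (simp add: o_def)
    qed
    have "u (- (- t)) = v (- (- t))"
      using ode_unique_forward[of "\<lambda>s. u (- s)" "\<lambda>s. v (- s)" "- 1" "- t", OF _ rev[OF u] rev[OF v]]
        assms(1) False by simp
    then show ?thesis
      by simp
  qed
qed

text \<open>\<open>flow\<close> is a definite description, so its properties need existence and
  uniqueness on the whole line together. The field \<open>f (u s)\<close> looks only at the present,
  a special case of a causal operator.\<close>

lemma flow_props: "flow f 0 x = x" "((\<lambda>t. flow f t x) has_vector_derivative f (flow f s x)) (at s)"
proof -
  obtain u where u: "u 0 = x" "\<And>t. (u has_vector_derivative f (u t)) (at t)"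
  proof (rule causal_ode_exists[of L "\<lambda>u s. f (u s)" B x])
    show "continuous_on UNIV (\<lambda>s. f (u s))" if "continuous_on UNIV u" for u :: "real \<Rightarrow> real^'d"
      by (rule continuous_on_compose2[OF continuous_fields(1) that]) auto
    show "norm (f (u s) - f (v s)) \<le> L * m"
      if "\<forall>r. \<bar>r\<bar> \<le> \<bar>s\<bar> \<longrightarrow> norm (u r - v r) \<le> m" for u v :: "real \<Rightarrow> real^'d" and s m
      using that by (intro norm_lipschitz_le) simp
  qed (use L_pos norm_bound in auto)
  have "(\<lambda>t. flow f t x) = u"
    unfolding flow_def
    by (rule ext, rule arg_cong[where f = "\<lambda>u. u _"], rule the_equality) (use u ode_unique in auto)
  then show "flow f 0 x = x" "((\<lambda>t. flow f t x) has_vector_derivative f (flow f s x)) (at s)"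
    using u by (simp_all add: fun_eq_iff)
qed

lemma flow_unique:
  assumes "\<And>s. (u has_vector_derivative f (u s)) (at s)"
  shows "u t = flow f t (u 0)"
proof -
  have "u = (\<lambda>t. flow f t (u 0))"
    by (rule ode_unique) (simp_all add: assms flow_props)
  then show ?thesis
    by (rule fun_cong)
qed

lemma flow_add: "flow f (s + t) x = flow f s (flow f t x)"
proof -
  have "((\<lambda>s. flow f (s + t) x) has_vector_derivative f (flow f (s + t) x)) (at s)" for s
  proof -
    have "(((\<lambda>t. flow f t x) \<circ> (\<lambda>s. s + t)) has_vector_derivative 1 *\<^sub>R f (flow f (s + t) x)) (at s)"
      by (rule vector_diff_chain_at) (auto intro!: derivative_eq_intros flow_props)
    then show ?thesis
      by (simp add: o_def)
  qed
  from flow_unique[OF this, of s] show ?thesis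
    by simp
qed

subsection \<open>The semiflow of the delay equation\<close>

text \<open>
  The concatenation of a history \<^term>\<open>\<phi>\<close> with a function \<^term>\<open>w\<close> is written without case
  distinction as \<^term>\<open>\<lambda>t. apply_bcontfun \<phi> (min t 0) - apply_bcontfun \<phi> 0 + w (max t 0)\<close>, so that its
  continuity does not depend on \<^term>\<open>w 0 = apply_bcontfun \<phi> 0\<close>.
\<close>

lemma continuous_on_clip:
  "continuous_on UNIV (\<lambda>t. apply_bcontfun \<phi> (min t 0) - x + w (max t 0))"
  if "continuous_on UNIV w" for \<phi> :: "'d hist" and w
  by (intro continuous_intros continuous_on_compose2[OF that]
      continuous_on_compose2[OF continuous_on_apply_bcontfun[of UNIV \<phi>]]) auto

text \<open>A bridge from curves on the whole line to solutions of the delay equation. It serves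
  existence and, with an orbit of the flow as \<open>w\<close>, the identification of the case
  \<open>\<epsilon> = 0\<close>.\<close>

lemma dde_solution_clip:
  assumes w0: "w 0 = apply_bcontfun \<phi> 0" and contw: "continuous_on UNIV w"
    and w: "\<And>s. s \<ge> 0 \<Longrightarrow> (w has_vector_derivative f (w s) +
      \<epsilon> *\<^sub>R g (apply_bcontfun \<phi> (min (s - \<tau>) 0) - apply_bcontfun \<phi> 0 + w (max (s - \<tau>) 0))) (at s)"
  shows "dde_solution f g \<tau> \<epsilon> \<phi> (\<lambda>t. apply_bcontfun \<phi> (min t 0) - apply_bcontfun \<phi> 0 + w (max t 0))"
    (is "dde_solution f g \<tau> \<epsilon> \<phi> ?u")
  unfolding dde_solution_def
proof (intro conjI ballI allI impI)
  show "continuous_on {- \<tau>..} ?u"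
    using continuous_on_clip[OF contw] by (rule continuous_on_subset) simp
  show "?u t = apply_bcontfun \<phi> t" if "t \<in> {- \<tau>..0}" for t
    using that w0 by simp
  show "(?u has_vector_derivative f (?u t) + \<epsilon> *\<^sub>R g (?u (t - \<tau>))) (at t within {0..})"
    if "0 \<le> t" for t
  proof (rule has_vector_derivative_transform)
    show "(w has_vector_derivative f (?u t) + \<epsilon> *\<^sub>R g (?u (t - \<tau>))) (at t within {0..})"
      using w[OF that] that by (auto intro: has_vector_derivative_at_within)
  qed (use that in auto)
qed

text \<open>The history enters \<open>\<Theta>\<close> as fixed data and only the curve after time 0
  is unknown. This handles all delay intervals at once, in place of the method of steps.\<close>

lemma dde_solution_exists: "\<exists>u. dde_solution f g \<tau> \<epsilon> \<phi> u"
proof -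
  define \<Theta> where "\<Theta> w s = f (w s) +
      \<epsilon> *\<^sub>R g (apply_bcontfun \<phi> (min (s - \<tau>) 0) - apply_bcontfun \<phi> 0 + w (max (s - \<tau>) 0))"
    for w :: "real \<Rightarrow> real^'d" and s
  obtain w where w: "w 0 = apply_bcontfun \<phi> 0" "\<And>t. (w has_vector_derivative \<Theta> w t) (at t)"
  proof (rule causal_ode_exists[of "(1 + \<bar>\<epsilon>\<bar>) * L" \<Theta> "(1 + \<bar>\<epsilon>\<bar>) * B"])
    show "continuous_on UNIV (\<Theta> u)" if u: "continuous_on UNIV u" for u
    proof -
      have "continuous_on UNIV ((\<lambda>t. apply_bcontfun \<phi> (min t 0) - apply_bcontfun \<phi> 0 + u (max t 0))
          \<circ> (\<lambda>s. s - \<tau>))"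
        by (intro continuous_on_compose continuous_intros continuous_on_subset[OF continuous_on_clip[OF u]])
          auto
      then have "continuous_on UNIV (\<lambda>s. g (apply_bcontfun \<phi> (min (s - \<tau>) 0) - apply_bcontfun \<phi> 0 + u (max (s - \<tau>) 0)))"
        unfolding o_def by (rule continuous_on_compose2[OF continuous_fields(2)[of UNIV]]) auto
      moreover have "continuous_on UNIV (\<lambda>s. f (u s))"
        by (rule continuous_on_compose2[OF continuous_fields(1)[of UNIV] u]) auto
      ultimately show ?thesis
        unfolding \<Theta>_def by (intro continuous_on_add continuous_on_scaleR continuous_on_const)
    qed
    show "norm (\<Theta> u s) \<le> (1 + \<bar>\<epsilon>\<bar>) * B" for u s
    proof -
      have "norm (x + \<epsilon> *\<^sub>R y) \<le> (1 + \<bar>\<epsilon>\<bar>) * B" if "norm x \<le> B" "norm y \<le> B" for x y :: "real^'d"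
        using norm_triangle_ineq[of x "\<epsilon> *\<^sub>R y"] mult_left_mono[OF that(2), of "\<bar>\<epsilon>\<bar>"] that(1)
        by (simp add: algebra_simps)
      then show ?thesis
        unfolding \<Theta>_def using norm_bound by blast
    qed
    show "norm (\<Theta> u s - \<Theta> v s) \<le> (1 + \<bar>\<epsilon>\<bar>) * L * m"
      if m: "\<forall>r. \<bar>r\<bar> \<le> \<bar>s\<bar> \<longrightarrow> norm (u r - v r) \<le> m" for u v s m
    proof -
      define x where "x = apply_bcontfun \<phi> (min (s - \<tau>) 0) - apply_bcontfun \<phi> 0"
      have 1: "norm (f (u s) - f (v s)) \<le> L * m"
        using m by (intro norm_lipschitz_le) simp
      \<comment> \<open>Since \<open>\<bar>max (s - \<tau>) 0\<bar> \<le> \<bar>s\<bar>\<close>, the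
        delayed value lies in the range where \<open>m\<close> bounds the difference.\<close>
      have "norm (g (x + u (max (s - \<tau>) 0)) - g (x + v (max (s - \<tau>) 0))) \<le> L * m"
        using m pos by (intro norm_lipschitz_le) auto
      then have 2: "\<bar>\<epsilon>\<bar> * norm (g (x + u (max (s - \<tau>) 0)) - g (x + v (max (s - \<tau>) 0)))
          \<le> \<bar>\<epsilon>\<bar> * (L * m)"
        by (intro mult_left_mono) auto
      have "\<Theta> u s - \<Theta> v s = (f (u s) - f (v s)) +
          \<epsilon> *\<^sub>R (g (x + u (max (s - \<tau>) 0)) - g (x + v (max (s - \<tau>) 0)))"
        by (simp add: \<Theta>_def x_def algebra_simps)
      also have "norm \<dots> \<le> L * m + \<bar>\<epsilon>\<bar> * (L * m)"
        using 1 2 by (intro norm_triangle_le add_mono) auto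
      finally show ?thesis
        by (simp add: algebra_simps)
    qed
  qed (use L_pos in \<open>auto intro!: mult_pos_pos\<close>)
  moreover have "continuous_on UNIV w"
    using w(2) by (meson continuous_at_imp_continuous_on has_vector_derivative_continuous)
  ultimately have "dde_solution f g \<tau> \<epsilon> \<phi> (\<lambda>t. apply_bcontfun \<phi> (min t 0) - apply_bcontfun \<phi> 0 + w (max t 0))"
    by (intro dde_solution_clip) (auto simp: \<Theta>_def)
  then show ?thesis
    by blast
qed

lemma dde_solution_deriv:
  assumes "dde_solution f g \<tau> \<epsilon> \<phi> u" "t > 0"
  shows "(u has_vector_derivative f (u t) + \<epsilon> *\<^sub>R g (u (t - \<tau>))) (at t)"
proof -
  have "at t within {0..} = at t"
    using \<open>t > 0\<close> by (intro at_within_interior) simp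
  moreover have "(u has_vector_derivative f (u t) + \<epsilon> *\<^sub>R g (u (t - \<tau>))) (at t within {0..})"
    using assms by (simp add: dde_solution_def)
  ultimately show ?thesis
    by simp
qed

text \<open>Present and delayed terms each contribute \<open>L\<close>, so Gronwall applies with
  \<open>2 * L\<close> and yields the rate \<open>4 * L\<close>. For equal data the bound is zero,
  hence the estimate also contains uniqueness.\<close>

lemma dde_solution_dependence:
  assumes u: "dde_solution f g \<tau> \<epsilon> \<phi> u" and v: "dde_solution f g \<tau> \<epsilon>' \<psi> v"
    and "\<bar>\<epsilon>\<bar> \<le> 1" and t: "t \<in> {- \<tau>..T}" "0 \<le> T"
  shows "norm (u t - v t) \<le> (3 * dist \<phi> \<psi> + \<bar>\<epsilon> - \<epsilon>'\<bar> * B / L) * exp (4 * L * T)"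
proof -
  define b where "b = L * dist \<phi> \<psi> + \<bar>\<epsilon> - \<epsilon>'\<bar> * B"
  have b: "b \<ge> 0"
    using L_pos B_pos by (simp add: b_def)
  have hist: "norm (u s - v s) \<le> dist \<phi> \<psi>" if "s \<in> {- \<tau>..0}" for s
    using u v that dist_bounded[of \<phi> s \<psi>] by (simp add: dde_solution_def dist_norm)
  show ?thesis
  proof (cases "t \<ge> 0")
    case False
    have "dist \<phi> \<psi> * 1 \<le> (3 * dist \<phi> \<psi> + \<bar>\<epsilon> - \<epsilon>'\<bar> * B / L) * exp (4 * L * T)"
      using t L_pos B_pos by (intro mult_mono) auto
    then show ?thesis
      using hist[of t] t False by simp
  next
    case True
    have "norm (u t - v t) \<le> (2 * norm (u 0 - v 0) + b / (2 * L)) * exp (2 * (2 * L) * t)"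
    proof (rule gronwall_causal[where T = T and w = "\<lambda>t. u t - v t"])
      show "continuous_on {0..T} (\<lambda>t. u t - v t)"
        using u v pos by (intro continuous_intros)
          (auto simp: dde_solution_def elim!: continuous_on_subset)
      show "((\<lambda>t. u t - v t) has_vector_derivative
          (f (u s) + \<epsilon> *\<^sub>R g (u (s - \<tau>))) - (f (v s) + \<epsilon>' *\<^sub>R g (v (s - \<tau>)))) (at s)" if "0 < s" for s
        by (intro derivative_intros dde_solution_deriv[OF u that] dde_solution_deriv[OF v that])
      show "norm ((f (u s) + \<epsilon> *\<^sub>R g (u (s - \<tau>))) - (f (v s) + \<epsilon>' *\<^sub>R g (v (s - \<tau>)))) \<le> 2 * L * m + b"
        if s: "0 < s" and m: "\<forall>r\<in>{0..s}. norm (u r - v r) \<le> m" for s m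
      proof -
        have m0: "m \<ge> 0"
          using order_trans[OF norm_ge_zero m[rule_format, of 0]] s by simp
        \<comment> \<open>The delayed time lies either in the future part, controlled by
          \<open>m\<close>, or in the histories, controlled by their distance.\<close>
        have past: "norm (u (s - \<tau>) - v (s - \<tau>)) \<le> m + dist \<phi> \<psi>"
        proof (cases "s - \<tau> \<ge> 0")
          case True
          then have "norm (u (s - \<tau>) - v (s - \<tau>)) \<le> m"
            using m pos by simp
          then show ?thesis
            using zero_le_dist[of \<phi> \<psi>] by linarith
        next
          case False
          then show ?thesis
            using hist[of "s - \<tau>"] s m0 by simp
        qed
        have 1: "norm (f (u s) - f (v s)) \<le> L * m"
          using m s by (intro norm_lipschitz_le) simp
        have "norm (g (u (s - \<tau>)) - g (v (s - \<tau>))) \<le> L * (m + dist \<phi> \<psi>)"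
          using past by (rule norm_lipschitz_le)
        then have "\<bar>\<epsilon>\<bar> * norm (g (u (s - \<tau>)) - g (v (s - \<tau>))) \<le> 1 * (L * (m + dist \<phi> \<psi>))"
          using \<open>\<bar>\<epsilon>\<bar> \<le> 1\<close> by (intro mult_mono) auto
        then have 2: "norm (\<epsilon> *\<^sub>R (g (u (s - \<tau>)) - g (v (s - \<tau>)))) \<le> L * (m + dist \<phi> \<psi>)"
          by simp
        have 3: "norm ((\<epsilon> - \<epsilon>') *\<^sub>R g (v (s - \<tau>))) \<le> \<bar>\<epsilon> - \<epsilon>'\<bar> * B"
          using norm_bound(2) by (auto intro!: mult_left_mono)
        \<comment> \<open>The splitting puts \<open>\<epsilon>\<close> next to the Lipschitz
          difference and \<open>\<epsilon> - \<epsilon>'\<close> next to the bounded value of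
          \<open>g\<close>, so a bound on \<open>\<epsilon>\<close> alone suffices.\<close>
        have "(f (u s) + \<epsilon> *\<^sub>R g (u (s - \<tau>))) - (f (v s) + \<epsilon>' *\<^sub>R g (v (s - \<tau>)))
            = (f (u s) - f (v s)) + (\<epsilon> *\<^sub>R (g (u (s - \<tau>)) - g (v (s - \<tau>))) + (\<epsilon> - \<epsilon>') *\<^sub>R g (v (s - \<tau>)))"
          by (simp add: algebra_simps)
        also have "norm \<dots> \<le> L * m + (L * (m + dist \<phi> \<psi>) + \<bar>\<epsilon> - \<epsilon>'\<bar> * B)"
          using 1 2 3 by (intro norm_triangle_le add_mono) auto
        also have "\<dots> = 2 * L * m + b"
          by (simp add: b_def algebra_simps)
        finally show ?thesis .
      qed
    qed (use True t L_pos b in auto)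
    also have "\<dots> \<le> (3 * dist \<phi> \<psi> + \<bar>\<epsilon> - \<epsilon>'\<bar> * B / L) * exp (4 * L * T)"
    proof (intro mult_mono)
      have "\<bar>\<epsilon> - \<epsilon>'\<bar> * B / (2 * L) \<le> \<bar>\<epsilon> - \<epsilon>'\<bar> * B / L"
        using L_pos B_pos by (intro divide_left_mono) auto
      \<comment> \<open>The coefficient of the distance is 2 plus one half, rounded up to 3.\<close>
      moreover have "b / (2 * L) = dist \<phi> \<psi> / 2 + \<bar>\<epsilon> - \<epsilon>'\<bar> * B / (2 * L)"
        using L_pos by (simp add: b_def field_simps)
      moreover have "norm (u 0 - v 0) \<le> dist \<phi> \<psi>"
        using hist[of 0] pos by simp
      ultimately show "2 * norm (u 0 - v 0) + b / (2 * L) \<le> 3 * dist \<phi> \<psi> + \<bar>\<epsilon> - \<epsilon>'\<bar> * B / L"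
        using zero_le_dist[of \<phi> \<psi>] by linarith
      show "exp (2 * (2 * L) * t) \<le> exp (4 * L * T)"
        using t L_pos by simp
    qed (use L_pos B_pos in auto)
    finally show ?thesis .
  qed
qed

abbreviation "sol \<epsilon> \<phi> \<equiv> dde_sol f g \<tau> \<epsilon> \<phi>"

lemma dde_sol: "dde_solution f g \<tau> \<epsilon> \<phi> (sol \<epsilon> \<phi>)"
  unfolding dde_sol_def using dde_solution_exists by (rule someI_ex)

lemma sol_hist: "t \<in> {- \<tau>..0} \<Longrightarrow> sol \<epsilon> \<phi> t = apply_bcontfun \<phi> t"
  and sol_cont: "continuous_on {- \<tau>..} (sol \<epsilon> \<phi>)"
  using dde_sol[of \<epsilon> \<phi>] by (auto simp: dde_solution_def)

text \<open>The history continued by the orbit of the flow solves the equation for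
  \<open>\<epsilon> = 0\<close>, and the dependence estimate with equal data leaves no
  difference.\<close>

lemma sol_zero_eq_flow:
  assumes "0 \<le> t"
  shows "sol 0 \<phi> t = flow f t (apply_bcontfun \<phi> 0)"
proof -
  let ?w = "\<lambda>t. flow f t (apply_bcontfun \<phi> 0)"
  have "continuous_on UNIV ?w"
    using flow_props(2) by (meson continuous_at_imp_continuous_on has_vector_derivative_continuous)
  then have "dde_solution f g \<tau> 0 \<phi> (\<lambda>t. apply_bcontfun \<phi> (min t 0) - apply_bcontfun \<phi> 0 + ?w (max t 0))"
    by (intro dde_solution_clip) (auto simp: flow_props)
  from dde_solution_dependence[OF dde_sol[of 0 \<phi>] this, where t = t and T = t] show ?thesis
    using assms pos by simp
qed

definition lip_hist :: "real \<Rightarrow> 'd hist set" where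
  "lip_hist M = {\<phi> \<in> hist_space \<tau>. \<phi> - const_bcontfun (apply_bcontfun \<phi> 0) \<in> lipschitz_tails \<tau> M}"

lemma lip_hist_infnorm:
  "\<phi> \<in> lip_hist M \<Longrightarrow> s \<in> {- \<tau>..0} \<Longrightarrow> t \<in> {- \<tau>..0} \<Longrightarrow>
    infnorm (apply_bcontfun \<phi> t - apply_bcontfun \<phi> s) \<le> M * \<bar>t - s\<bar>"
  by (auto simp: lip_hist_def lipschitz_tails_def)

text \<open>Before time 0 the history has constant \<open>M\<close>, after it the right-hand side is
  bounded by \<open>M\<close>, and an interval that contains 0 is split there.\<close>

lemma sol_infnorm_lipschitz:
  assumes \<phi>: "\<phi> \<in> lip_hist M" and M: "Mf + \<bar>\<epsilon>\<bar> * Mg \<le> M" and "s \<ge> - \<tau>" "t \<ge> - \<tau>"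
  shows "infnorm (sol \<epsilon> \<phi> t - sol \<epsilon> \<phi> s) \<le> M * \<bar>t - s\<bar>"
proof -
  let ?u = "sol \<epsilon> \<phi>"
  have past: "infnorm (?u t - ?u s) \<le> M * (t - s)" if "- \<tau> \<le> s" "s \<le> t" "t \<le> 0" for s t
    using lip_hist_infnorm[OF \<phi>, of s t] that by (simp add: sol_hist)
  have future: "infnorm (?u t - ?u s) \<le> M * (t - s)" if "0 \<le> s" "s \<le> t" for s t
  proof (rule infnorm_diff_le_of_derivative)
    show "(?u has_vector_derivative f (?u r) + \<epsilon> *\<^sub>R g (?u (r - \<tau>))) (at r)" if "s < r" for r
      using that \<open>0 \<le> s\<close> by (intro dde_solution_deriv[OF dde_sol]) auto
    show "infnorm (f (?u r) + \<epsilon> *\<^sub>R g (?u (r - \<tau>))) \<le> M" for r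
    proof -
      have "infnorm (f (?u r) + \<epsilon> *\<^sub>R g (?u (r - \<tau>)))
          \<le> infnorm (f (?u r)) + \<bar>\<epsilon>\<bar> * infnorm (g (?u (r - \<tau>)))"
        using infnorm_triangle[of "f (?u r)" "\<epsilon> *\<^sub>R g (?u (r - \<tau>))"] by (simp add: infnorm_mul)
      also have "\<dots> \<le> Mf + \<bar>\<epsilon>\<bar> * Mg"
        using bound by (intro add_mono mult_left_mono) auto
      also note M
      finally show ?thesis .
    qed
  qed (use that pos in \<open>auto intro: continuous_on_subset[OF sol_cont]\<close>)
  have "infnorm (?u t - ?u s) \<le> M * (t - s)" if "- \<tau> \<le> s" "s \<le> t" for s t
  proof (cases "0 \<le> s \<or> t \<le> 0")
    case False
    have "infnorm (?u t - ?u s) \<le> infnorm (?u t - ?u 0) + infnorm (?u 0 - ?u s)"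
      using infnorm_triangle[of "?u t - ?u 0" "?u 0 - ?u s"] by simp
    also have "\<dots> \<le> M * (t - 0) + M * (0 - s)"
      using False that by (intro add_mono past future) auto
    finally show ?thesis
      by (simp add: algebra_simps)
  qed (use that past future in auto)
  from this[of s t] this[of t s] show ?thesis
    using assms by (cases "s \<le> t") (auto simp: infnorm_sub)
qed

lemma apply_dde_semiflow:
  assumes "0 \<le> t"
  shows "apply_bcontfun (dde_semiflow f g \<tau> \<epsilon> t \<phi>) s = sol \<epsilon> \<phi> (t + clamp (- \<tau>) 0 s)"
    and "dde_semiflow f g \<tau> \<epsilon> t \<phi> \<in> hist_space \<tau>"
proof -
  have "continuous_on {- \<tau>..0} (\<lambda>s. sol \<epsilon> \<phi> (t + s))"
    using assms by (intro continuous_on_compose2[OF sol_cont] continuous_intros) auto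
  then show "apply_bcontfun (dde_semiflow f g \<tau> \<epsilon> t \<phi>) s = sol \<epsilon> \<phi> (t + clamp (- \<tau>) 0 s)"
    and "dde_semiflow f g \<tau> \<epsilon> t \<phi> \<in> hist_space \<tau>"
    using pos by (simp_all add: dde_semiflow_def apply_Bcontfun_ext_cont hist_space_Bcontfun)
qed

lemma apply_dde_semiflow_0: "0 \<le> t \<Longrightarrow> apply_bcontfun (dde_semiflow f g \<tau> \<epsilon> t \<phi>) 0 = sol \<epsilon> \<phi> t"
  using pos by (simp add: apply_dde_semiflow clamp_real_eq)

text \<open>This invariance is the reason for the constant of the tails. It also covers
  \<open>t < \<tau>\<close>, when the segment still contains a piece of the old history.\<close>

lemma dde_semiflow_lip_hist:
  assumes "\<phi> \<in> lip_hist M" "Mf + \<bar>\<epsilon>\<bar> * Mg \<le> M" "0 \<le> t"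
  shows "dde_semiflow f g \<tau> \<epsilon> t \<phi> \<in> lip_hist M"
proof -
  have "infnorm (sol \<epsilon> \<phi> (t + s) - sol \<epsilon> \<phi> (t + r)) \<le> M * \<bar>s - r\<bar>"
    if "s \<in> {- \<tau>..0}" "r \<in> {- \<tau>..0}" for s r
    using sol_infnorm_lipschitz[OF assms(1,2), of "t + r" "t + s"] that assms(3) by simp
  then show ?thesis
    using apply_dde_semiflow[OF assms(3), of \<epsilon> \<phi>]
    by (auto simp: lip_hist_def lipschitz_tails_def tail_space_def hist_space_iff clamp_real_eq)
qed

text \<open>Time is changed first along the perturbed solution, at the cost of its Lipschitz
  constant; then parameter and history are changed at the fixed time \<open>t\<close>.
  \<open>F\<close> adds the two costs and tends to 0.\<close>

lemma continuous_on_dde_semiflow: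
  "continuous_on ({-1..1} \<times> {0..} \<times> lip_hist (Mf + Mg))
    (\<lambda>(\<epsilon>, t, \<phi>). dde_semiflow f g \<tau> \<epsilon> t \<phi>)"
  (is "continuous_on ?D ?F")
proof -
  define M where "M = rootd * (Mf + Mg)"
  define F where "F e t' \<epsilon> t \<phi> \<psi> = M * \<bar>t' - t\<bar> +
    (3 * dist \<psi> \<phi> + \<bar>e - \<epsilon>\<bar> * B / L) * exp (4 * L * t)" for e t' \<epsilon> t :: real and \<phi> \<psi> :: "'d hist"
  have est: "dist (dde_semiflow f g \<tau> e t' \<psi>) (dde_semiflow f g \<tau> \<epsilon> t \<phi>) \<le> F e t' \<epsilon> t \<phi> \<psi>"
    if "e \<in> {-1..1}" "0 \<le> t" "0 \<le> t'" and \<psi>: "\<psi> \<in> lip_hist (Mf + Mg)"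
    for e t' \<epsilon> t :: real and \<phi> \<psi> :: "'d hist"
  proof (rule dist_bound)
    fix s
    define r where "r = clamp (- \<tau>) 0 s"
    have r: "- \<tau> \<le> r" "r \<le> 0"
      using clamp_real_mem[of "- \<tau>" 0 s] pos by (auto simp: r_def)
    have "infnorm (sol e \<psi> (t' + r) - sol e \<psi> (t + r)) \<le> (Mf + Mg) * \<bar>(t' + r) - (t + r)\<bar>"
      using that r pos by (intro sol_infnorm_lipschitz[OF \<psi>]) (auto simp: abs_le_iff)
    then have "rootd * infnorm (sol e \<psi> (t' + r) - sol e \<psi> (t + r)) \<le> M * \<bar>t' - t\<bar>"
      using rootd_pos by (simp add: M_def)
    then have 1: "norm (sol e \<psi> (t' + r) - sol e \<psi> (t + r)) \<le> M * \<bar>t' - t\<bar>"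
      using norm_le_rootd_infnorm order_trans by blast
    have 2: "norm (sol e \<psi> (t + r) - sol \<epsilon> \<phi> (t + r))
        \<le> (3 * dist \<psi> \<phi> + \<bar>e - \<epsilon>\<bar> * B / L) * exp (4 * L * t)"
      using r that by (intro dde_solution_dependence[OF dde_sol dde_sol]) auto
    have "norm (sol e \<psi> (t' + r) - sol \<epsilon> \<phi> (t + r)) \<le> F e t' \<epsilon> t \<phi> \<psi>"
      unfolding F_def using norm_triangle_mono[OF 1 2] by simp
    then show "dist (apply_bcontfun (dde_semiflow f g \<tau> e t' \<psi>) s)
        (apply_bcontfun (dde_semiflow f g \<tau> \<epsilon> t \<phi>) s) \<le> F e t' \<epsilon> t \<phi> \<psi>"
      using that by (simp add: apply_dde_semiflow dist_norm r_def)
  qed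
  show ?thesis
    unfolding continuous_on_def
  proof
    fix z
    assume "z \<in> ?D"
    then obtain \<epsilon> t \<phi> where z: "z = (\<epsilon>, t, \<phi>)"
      and *: "\<epsilon> \<in> {-1..1}" "0 \<le> t" "\<phi> \<in> lip_hist (Mf + Mg)"
      by auto
    have "((\<lambda>(e, t', \<psi>). F e t' \<epsilon> t \<phi> \<psi>) \<longlongrightarrow> M * \<bar>t - t\<bar> +
        (3 * dist \<phi> \<phi> + \<bar>\<epsilon> - \<epsilon>\<bar> * B / L) * exp (4 * L * t)) (at (\<epsilon>, t, \<phi>) within ?D)"
      unfolding F_def case_prod_beta using L_pos by (auto intro!: tendsto_eq_intros)
    then have lim: "((\<lambda>(e, t', \<psi>). F e t' \<epsilon> t \<phi> \<psi>) \<longlongrightarrow> 0) (at (\<epsilon>, t, \<phi>) within ?D)"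
      by simp
    have ev: "\<forall>\<^sub>F z in at (\<epsilon>, t, \<phi>) within ?D.
        norm (dist (?F z) (?F (\<epsilon>, t, \<phi>))) \<le> (\<lambda>(e, t', \<psi>). F e t' \<epsilon> t \<phi> \<psi>) z"
      unfolding eventually_at_filter by (intro always_eventually) (use est * in auto)
    have "((\<lambda>z. dist (?F z) (?F (\<epsilon>, t, \<phi>))) \<longlongrightarrow> 0) (at (\<epsilon>, t, \<phi>) within ?D)"
      by (rule Lim_null_comparison[OF ev lim])
    then show "(?F \<longlongrightarrow> ?F z) (at z within ?D)"
      unfolding z tendsto_dist_iff[of ?F] .
  qed
qed

end

subsection \<open>Sections and return maps\<close>

lemma continuous_on_const_bcontfun: "continuous_on A const_bcontfun"
proof -
  have "dist (const_bcontfun a :: 'b::topological_space \<Rightarrow>\<^sub>C 'c::metric_space) (const_bcontfun b) \<le> dist a b" for a b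
    by (rule dist_bound) simp
  then show ?thesis
    unfolding continuous_on_iff using le_less_trans by blast
qed

text \<open>The projection of a compact graph to its Hausdorff base is a continuous bijection, so
  its inverse is continuous. This replaces an implicit function theorem for the return time.\<close>

lemma continuous_on_compact_graph:
  fixes G :: "('a::t2_space \<times> 'b::topological_space) set"
  assumes "compact G" "fst ` G = Z" "\<And>z s. (z, s) \<in> G \<Longrightarrow> h z = s"
  shows "continuous_on Z h"
proof -
  have "continuous_on (fst ` G) (\<lambda>z. (z, h z))"
    by (rule continuous_on_inv) (use assms in \<open>auto intro!: continuous_intros\<close>)
  then have "continuous_on Z (\<lambda>z. snd (z, h z))"
    using assms(2) by (intro continuous_on_snd) simp
  then show ?thesis
    by simp
qed

text \<open>The tube lemma: an open condition on the slice over 0 extends to a strip because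
  \<open>Q\<close> is compact.\<close>

lemma near_zero_parameter:
  fixes Y :: "real \<times> 'a::t2_space \<Rightarrow> 'b::topological_space"
  assumes "compact Q" "continuous_on ({-1..1} \<times> Q) Y" "open W" "\<And>q. q \<in> Q \<Longrightarrow> Y (0, q) \<in> W"
  obtains e where "0 < e" "e \<le> 1" "\<And>\<epsilon> q. \<bar>\<epsilon>\<bar> \<le> e \<Longrightarrow> q \<in> Q \<Longrightarrow> Y (\<epsilon>, q) \<in> W"
proof -
  obtain O' where O': "open O'" "O' \<inter> ({-1..1} \<times> Q) = Y -` W \<inter> ({-1..1} \<times> Q)"
    using assms(2,3) by (auto simp: continuous_on_open_invariant)
  have "{0} \<times> Q \<subseteq> O'"
    using O'(2) assms(4) by force
  then obtain X where X: "0 \<in> X" "open X" "X \<times> Q \<subseteq> O'"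
    using Elementary_Topology.tube_lemma[OF assms(1) O'(1), of 0] by blast
  then obtain d where d: "d > 0" "cball 0 d \<subseteq> X"
    using open_contains_cball by blast
  show ?thesis
  proof (rule that[of "min d 1"])
    show "Y (\<epsilon>, q) \<in> W" if "\<bar>\<epsilon>\<bar> \<le> min d 1" "q \<in> Q" for \<epsilon> q
    proof -
      have "(\<epsilon>, q) \<in> O' \<inter> ({-1..1} \<times> Q)"
        using that d X by (auto simp: abs_le_iff)
      then show ?thesis
        using O'(2) by blast
    qed
  qed (use d in auto)
qed

lemma frechet_derivative_eq_grad:
  assumes "F differentiable (at x)"
  shows "frechet_derivative F (at x) v = grad F x \<bullet> v"
proof -
  let ?D = "frechet_derivative F (at x)"
  have lin: "linear ?D"
    using assms by (rule linear_frechet_derivative)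
  have "?D v = ?D (\<Sum>i\<in>UNIV. (v $ i) *\<^sub>R axis i 1)"
    using basis_expansion[of v] by (simp add: scalar_mult_eq_scaleR)
  also have "\<dots> = (\<Sum>i\<in>UNIV. v $ i * ?D (axis i 1))"
    by (simp add: linear_sum[OF lin] linear_cmul[OF lin])
  also have "\<dots> = grad F x \<bullet> v"
    by (simp add: grad_def inner_vec_def mult.commute)
  finally show ?thesis .
qed

locale section_data = dde_data f g \<tau> Mf Mg Lf Lg
  for f g :: "real^'d \<Rightarrow> real^'d" and \<tau> Mf Mg Lf Lg :: real +
  fixes S :: "(real^'d) set" and \<delta> :: real and \<alpha> :: "real^'d \<Rightarrow> real"
    and V :: "'m::finite coords set" and \<kappa> :: "real^'d \<Rightarrow> 'm coords" and \<sigma> :: "'m coords \<Rightarrow> real^'d"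
    and \<eta> :: real
  assumes dim: "CARD('d) = CARD('m) + 2"
    and sect: "is_section TYPE('m) f S \<delta> \<alpha>"
    and chart: "coord_diffeo S V \<kappa> \<sigma>"
    and return: "\<forall>u\<in>S. \<exists>t>0. flow f t u \<in> S"
    and return_time_cont: "continuous_on S (return_time f S)"
    and window: "0 < \<eta>" "\<eta> < \<delta>"
begin

abbreviation "U \<equiv> flow_box f S \<delta>"

abbreviation "rt \<equiv> return_time f S"

lemma delta_pos: "\<delta> > 0"
  using window by simp

lemma chart_props: "open V" "continuous_on V \<sigma>" "\<sigma> ` V = S" "continuous_on S \<kappa>" "inj_on \<sigma> V"
proof -
  have h: "homeomorphism S V \<kappa> \<sigma>" "open V"
    using chart by (auto simp: coord_diffeo_def)
  then show "open V" "continuous_on V \<sigma>" "\<sigma> ` V = S" "continuous_on S \<kappa>" "inj_on \<sigma> V"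
    by (auto simp: homeomorphism_def intro!: inj_on_inverseI[where g = \<kappa>])
qed

lemma flow_box_homeo:
  "continuous_on ({- \<delta><..<\<delta>} \<times> S) (\<lambda>(t, x). flow f t x)"
  "inj_on (\<lambda>(t, x). flow f t x) ({- \<delta><..<\<delta>} \<times> S)"
proof -
  obtain h where "homeomorphism ({- \<delta><..<\<delta>} \<times> S) U (\<lambda>(t, x). flow f t x) h"
    using sect by (auto simp: is_section_def)
  then show "continuous_on ({- \<delta><..<\<delta>} \<times> S) (\<lambda>(t, x). flow f t x)"
    "inj_on (\<lambda>(t, x). flow f t x) ({- \<delta><..<\<delta>} \<times> S)"
    by (auto simp: homeomorphism_def intro!: inj_on_inverseI[where g = h])
qed

text \<open>The chart turns the box into the injective continuous image of an open set in a space of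
  dimension \<open>CARD('m) + 2\<close>. By \<open>dim\<close> this is the dimension of the phase
  space, so invariance of domain applies.\<close>

lemma open_flow_box: "open U"
proof -
  let ?F = "(\<lambda>(t, x). flow f t x) \<circ> map_prod id \<sigma>" and ?D = "{- \<delta><..<\<delta>} \<times> V"
  have im: "map_prod id \<sigma> ` ?D = {- \<delta><..<\<delta>} \<times> S"
    using chart_props(3) by (simp add: map_prod_surj_on)
  have "open (?F ` ?D)"
  proof (rule invariance_of_domain_gen)
    show "open ?D"
      using chart_props by (intro open_Times) auto
    have "continuous_on ?D (map_prod id \<sigma>)"
      unfolding map_prod_def case_prod_beta id_def
      by (intro continuous_intros continuous_on_compose2[OF chart_props(2)]) auto
    then show "continuous_on ?D ?F"
      using flow_box_homeo(1) by (intro continuous_on_compose) (simp_all only: im)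
    have "inj_on (map_prod id \<sigma>) ?D"
      using chart_props(5) by (intro map_prod_inj_on) auto
    then show "inj_on ?F ?D"
      using flow_box_homeo(2) by (intro comp_inj_on) (simp_all only: im)
    show "DIM(real^'d) \<le> DIM(real \<times> 'm coords)"
      using dim by simp
  qed
  moreover have "?F ` ?D = U"
    unfolding image_comp[symmetric] im flow_box_def ..
  ultimately show ?thesis
    by (simp only:)
qed

lemma flow_in_box: "x \<in> S \<Longrightarrow> \<bar>t\<bar> < \<delta> \<Longrightarrow> flow f t x \<in> U"
  by (force simp: flow_box_def)

lemma section_iff: "u \<in> S \<longleftrightarrow> u \<in> U \<and> \<alpha> u = 0"
  using sect unfolding is_section_def by blast

lemma alpha_sign:
  "x \<in> S \<Longrightarrow> - \<delta> < t \<Longrightarrow> t < 0 \<Longrightarrow> \<alpha> (flow f t x) < 0"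
  "x \<in> S \<Longrightarrow> 0 < t \<Longrightarrow> t < \<delta> \<Longrightarrow> \<alpha> (flow f t x) > 0"
  using sect unfolding is_section_def by auto

lemma alpha_transversal: obtains a where "a > 0" "\<And>u. u \<in> U \<Longrightarrow> a \<le> grad \<alpha> u \<bullet> f u"
  using sect unfolding is_section_def by blast

lemma alpha_differentiable: "u \<in> U \<Longrightarrow> \<alpha> differentiable (at u)"
  and alpha_C1: "continuous_on U (\<lambda>u. frechet_derivative \<alpha> (at u) v)"
  using sect unfolding is_section_def by (simp_all only: One_nat_def Ck_on.simps)

lemma alpha_continuous: "continuous_on U \<alpha>"
  using alpha_differentiable
  by (meson continuous_at_imp_continuous_on differentiable_imp_continuous_within)

lemma grad_continuous: "continuous_on U (grad \<alpha>)"
  unfolding grad_def by (intro continuous_intros alpha_C1)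

lemma alpha_chain:
  assumes "(u has_vector_derivative v) (at t)" "u t \<in> U"
  shows "((\<lambda>t. \<alpha> (u t)) has_real_derivative grad \<alpha> (u t) \<bullet> v) (at t)"
proof -
  have "(\<alpha> has_derivative frechet_derivative \<alpha> (at (u t))) (at (u t))"
    using alpha_differentiable[OF assms(2)] by (simp add: frechet_derivative_works)
  then have "((\<lambda>t. \<alpha> (u t)) has_derivative (\<lambda>h. frechet_derivative \<alpha> (at (u t)) (h *\<^sub>R v))) (at t)"
    using assms(1) unfolding has_vector_derivative_def by (rule has_derivative_compose[rotated])
  moreover have "(\<lambda>h. frechet_derivative \<alpha> (at (u t)) (h *\<^sub>R v)) = (*) (grad \<alpha> (u t) \<bullet> v)"
    using alpha_differentiable[OF assms(2)] by (simp add: frechet_derivative_eq_grad fun_eq_iff)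
  ultimately show ?thesis
    by (simp add: has_field_derivative_def)
qed

text \<open>Otherwise the midpoint of the orbit segment would have two representations in the flow box.\<close>

lemma no_early_return:
  assumes "x \<in> S" "0 < t" "t < 2 * \<delta>"
  shows "flow f t x \<notin> S"
proof
  assume *: "flow f t x \<in> S"
  have "flow f (- (t / 2)) (flow f t x) = flow f (t / 2) x"
    by (simp flip: flow_add)
  then have "(- (t / 2), flow f t x) = (t / 2, x)"
    using assms * by (intro inj_onD[OF flow_box_homeo(2)]) auto
  then show False
    using assms by simp
qed

text \<open>This lower bound keeps the window of half-width \<open>\<eta> < \<delta>\<close> around
  the return time at positive times.\<close>

lemma return_time_ge:
  assumes "x \<in> S"
  shows "2 * \<delta> \<le> rt x"
  unfolding return_time_def
proof (rule cInf_greatest)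
  show "{t. 0 < t \<and> flow f t x \<in> S} \<noteq> {}"
    using return assms by auto
qed (use no_early_return[OF assms] in force)

text \<open>The infimum is attained because returns are separated, not because \<open>S\<close> is
  closed: two distinct return times less than \<open>2 * \<delta>\<close> apart would contradict
  \<open>no_early_return\<close>.\<close>

lemma flow_return_time:
  assumes "x \<in> S"
  shows "flow f (rt x) x \<in> S"
proof -
  define R where "R = {t. 0 < t \<and> flow f t x \<in> S}"
  have R: "R \<noteq> {}" and Inf: "rt x = Inf R"
    using return assms by (auto simp: R_def return_time_def)
  have bdd: "bdd_below R"
    by (auto simp: R_def intro!: bdd_belowI[of _ 0])
  obtain t where t: "t \<in> R" "t < Inf R + 2 * \<delta>"
    using cInf_lessD[OF R, of "Inf R + 2 * \<delta>"] delta_pos by auto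
  have "Inf R = t"
  proof (rule ccontr)
    assume "Inf R \<noteq> t"
    then have "Inf R < t"
      using cInf_lower[OF t(1) bdd] by simp
    then obtain t' where t': "t' \<in> R" "t' < t"
      using cInf_lessD[OF R] by auto
    then have "t - t' < 2 * \<delta>"
      using cInf_lower[OF t'(1) bdd] t by simp
    moreover have "flow f (t - t') (flow f t' x) = flow f t x"
      by (simp flip: flow_add)
    ultimately show False
      using no_early_return[of "flow f t' x" "t - t'"] t t' by (simp add: R_def)
  qed
  then show ?thesis
    using t by (simp add: Inf R_def)
qed

lemma flow_near_return:
  assumes "x \<in> S"
  shows "flow f (rt x + s) x = flow f s (poincare_map f S x)" "poincare_map f S x \<in> S"
  using flow_return_time[OF assms] by (simp_all add: poincare_map_def add.commute flip: flow_add)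

lemma of_coords_0: "r \<in> lipschitz_tails \<tau> M \<Longrightarrow> apply_bcontfun (of_coords \<sigma> (x, r)) 0 = \<sigma> x"
  by (simp add: of_coords_def lipschitz_tails_def tail_space_def)

lemma of_coords_lip_hist:
  assumes "r \<in> lipschitz_tails \<tau> M"
  shows "of_coords \<sigma> (x, r) \<in> lip_hist M"
  using assms of_coords_0[OF assms, of x]
  by (auto simp: lip_hist_def of_coords_def lipschitz_tails_def tail_space_def hist_space_iff)

section \<open>Return times and the return map in coordinates\<close>

abbreviation "tails \<equiv> lipschitz_tails \<tau> (Mf + Mg) :: 'd hist set"

text \<open>The time \<open>s\<close> is an offset from the return time of the unperturbed flow, so
  that the window becomes the fixed interval from \<open>- \<eta>\<close> to \<open>\<eta>\<close>
  for all \<open>x\<close>.\<close>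

definition orbit :: "real \<times> real \<times> 'm coords \<times> 'd hist \<Rightarrow> 'd hist" where
  "orbit = (\<lambda>(\<epsilon>, s, x, r). dde_semiflow f g \<tau> \<epsilon> (rt (\<sigma> x) + s) (of_coords \<sigma> (x, r)))"

definition endpoint :: "real \<times> real \<times> 'm coords \<times> 'd hist \<Rightarrow> real^'d" where
  "endpoint q = apply_bcontfun (orbit q) 0"

lemma sigma_in: "x \<in> V \<Longrightarrow> \<sigma> x \<in> S"
  using chart_props by blast

lemma time_pos: "x \<in> V \<Longrightarrow> s \<in> {- \<eta>..\<eta>} \<Longrightarrow> rt (\<sigma> x) + s > 0"
  using return_time_ge[OF sigma_in, of x] window by simp

lemma continuous_on_orbit: "continuous_on ({-1..1} \<times> {- \<eta>..\<eta>} \<times> V \<times> tails) orbit"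
proof -
  let ?D = "{-1..1} \<times> {- \<eta>..\<eta>} \<times> V \<times> tails"
  let ?E = "{-1..1} \<times> {0..} \<times> lip_hist (Mf + Mg)"
  let ?h = "\<lambda>(\<epsilon>, s, x, r). (\<epsilon>, rt (\<sigma> x) + s, of_coords \<sigma> (x, r))"
  have sig: "continuous_on ?D (\<lambda>q. \<sigma> (fst (snd (snd q))))"
    by (intro continuous_on_compose2[OF chart_props(2)] continuous_intros) auto
  have "continuous_on ?D ?h"
    unfolding case_prod_beta of_coords_def fst_conv snd_conv
    by (intro continuous_on_Pair continuous_on_add continuous_on_fst continuous_on_snd continuous_on_id
        continuous_on_compose2[OF return_time_cont sig] continuous_on_compose2[OF continuous_on_const_bcontfun sig])
      (auto simp: sigma_in)
  moreover have "?h ` ?D \<subseteq> ?E"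
    using time_pos of_coords_lip_hist by (fastforce intro: less_imp_le)
  ultimately have "continuous_on ?D ((\<lambda>(\<epsilon>, t, \<phi>). dde_semiflow f g \<tau> \<epsilon> t \<phi>) \<circ> ?h)"
    by (intro continuous_on_compose continuous_on_subset[OF continuous_on_dde_semiflow])
  then show ?thesis
    by (simp add: o_def case_prod_beta orbit_def)
qed

lemma continuous_on_endpoint: "continuous_on ({-1..1} \<times> {- \<eta>..\<eta>} \<times> V \<times> tails) endpoint"
  unfolding endpoint_def
  by (rule continuous_on_compose2[OF continuous_on_apply_bcontfun_left[of UNIV] continuous_on_orbit]) auto

lemma endpoint_sol: "x \<in> V \<Longrightarrow> s \<in> {- \<eta>..\<eta>} \<Longrightarrow>
    endpoint (\<epsilon>, s, x, r) = sol \<epsilon> (of_coords \<sigma> (x, r)) (rt (\<sigma> x) + s)"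
  using time_pos[of x s] by (simp add: endpoint_def orbit_def apply_dde_semiflow_0)

lemma endpoint_0:
  assumes "x \<in> V" "s \<in> {- \<eta>..\<eta>}" "r \<in> tails"
  shows "endpoint (0, s, x, r) = flow f s (poincare_map f S (\<sigma> x))"
  using time_pos[OF assms(1,2)] flow_near_return(1)[OF sigma_in[OF assms(1)]]
  by (simp add: endpoint_def orbit_def apply_dde_semiflow_0 sol_zero_eq_flow of_coords_0[OF assms(3)])

lemma is_dde_return_time_iff:
  assumes "x \<in> V" "r \<in> tails"
  shows "is_dde_return_time f g \<tau> S \<eta> \<epsilon> (of_coords \<sigma> (x, r)) t \<longleftrightarrow>
    t - rt (\<sigma> x) \<in> {- \<eta>..\<eta>} \<and> endpoint (\<epsilon>, t - rt (\<sigma> x), x, r) \<in> S"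
  by (auto simp: is_dde_return_time_def endpoint_def orbit_def of_coords_0[OF assms(2)])

text \<open>Transversality bounds the derivative of \<open>\<alpha>\<close> along an orbit below by
  \<open>a\<close>, up to the term with \<open>\<epsilon>\<close>. Monotonicity gives uniqueness,
  and the signs at the two ends of the window give existence.\<close>

lemma unique_crossing:
  assumes "compact K" "K \<subseteq> V"
  obtains \<epsilon>0 where "0 < \<epsilon>0" "\<epsilon>0 \<le> 1"
    "\<And>\<epsilon> s x r. \<bar>\<epsilon>\<bar> \<le> \<epsilon>0 \<Longrightarrow> s \<in> {- \<eta>..\<eta>} \<Longrightarrow> x \<in> K \<Longrightarrow> r \<in> tails \<Longrightarrow> endpoint (\<epsilon>, s, x, r) \<in> U"
    "\<And>\<epsilon> x r. \<bar>\<epsilon>\<bar> \<le> \<epsilon>0 \<Longrightarrow> x \<in> K \<Longrightarrow> r \<in> tails \<Longrightarrow> \<exists>!s. s \<in> {- \<eta>..\<eta>} \<and> endpoint (\<epsilon>, s, x, r) \<in> S"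
proof -
  let ?I = "{- \<eta>..\<eta>}"
  define Q where "Q = ?I \<times> K \<times> tails"
  have Q: "compact Q"
    unfolding Q_def using assms pos by (intro compact_Times compact_lipschitz_tails) auto
  have cont: "continuous_on ({-1..1} \<times> Q) endpoint"
    by (rule continuous_on_subset[OF continuous_on_endpoint]) (use assms in \<open>auto simp: Q_def\<close>)
  have base: "endpoint (0, s, x, r) = flow f s (poincare_map f S (\<sigma> x))" "poincare_map f S (\<sigma> x) \<in> S"
    if "s \<in> ?I" "x \<in> K" "r \<in> tails" for s x r
    using that assms endpoint_0 flow_near_return(2) sigma_in by blast+
  have inU: "endpoint (0, q) \<in> U" if q: "q \<in> Q" for q
    using q window by (auto simp: Q_def base intro!: flow_in_box)
  have "continuous_on Q (\<lambda>q. norm (grad \<alpha> (endpoint (0, q))))"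
    by (intro continuous_on_norm continuous_on_compose2[OF grad_continuous]
        continuous_on_compose2[OF cont] continuous_intros) (use inU in auto)
  then have "bounded ((\<lambda>q. norm (grad \<alpha> (endpoint (0, q)))) ` Q)"
    using Q compact_continuous_image compact_imp_bounded by blast
  then obtain G where G: "G > 0" "\<And>q. q \<in> Q \<Longrightarrow> norm (grad \<alpha> (endpoint (0, q))) < G"
    unfolding bounded_pos_less by auto
  obtain a where a: "a > 0" "\<And>u. u \<in> U \<Longrightarrow> a \<le> grad \<alpha> u \<bullet> f u"
    by (rule alpha_transversal) blast
  \<comment> \<open>The strict bound by \<open>G\<close> makes \<open>W\<close> open, so the bound
    at \<open>\<epsilon> = 0\<close> persists for small \<open>\<epsilon>\<close>.\<close>
  define W where "W = U \<inter> (\<lambda>u. norm (grad \<alpha> u)) -` {..<G}"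
  have "open W"
    unfolding W_def using open_flow_box grad_continuous by (intro continuous_open_preimage continuous_on_norm) auto
  obtain e1 where e1: "0 < e1" "e1 \<le> 1" "\<And>\<epsilon> q. \<bar>\<epsilon>\<bar> \<le> e1 \<Longrightarrow> q \<in> Q \<Longrightarrow> endpoint (\<epsilon>, q) \<in> W"
    using near_zero_parameter[OF Q cont \<open>open W\<close>] inU G by (auto simp: W_def)
  \<comment> \<open>At offsets \<open>\<eta>\<close> and \<open>- \<eta>\<close> the unperturbed
    orbit lies strictly on one side of the section, and a strict sign is an open condition.\<close>
  have side: "\<exists>e>0. \<forall>\<epsilon> x r. \<bar>\<epsilon>\<bar> \<le> e \<longrightarrow> x \<in> K \<longrightarrow> r \<in> tails \<longrightarrow> endpoint (\<epsilon>, s, x, r) \<in> U \<inter> \<alpha> -` A"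
    if "open A" "s \<in> ?I" and A: "\<And>x. x \<in> S \<Longrightarrow> \<alpha> (flow f s x) \<in> A" for A s
  proof -
    have Qs: "compact ({s} \<times> K \<times> tails)"
      using assms pos by (intro compact_Times compact_lipschitz_tails) auto
    have conts: "continuous_on ({-1..1} \<times> {s} \<times> K \<times> tails) endpoint"
      by (rule continuous_on_subset[OF cont]) (use that in \<open>auto simp: Q_def\<close>)
    have op: "open (U \<inter> \<alpha> -` A)"
      using open_flow_box alpha_continuous \<open>open A\<close> by (intro continuous_open_preimage)
    obtain e where "0 < e" "\<And>\<epsilon> q. \<bar>\<epsilon>\<bar> \<le> e \<Longrightarrow> q \<in> {s} \<times> K \<times> tails \<Longrightarrow> endpoint (\<epsilon>, q) \<in> U \<inter> \<alpha> -` A"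
    proof (rule near_zero_parameter[OF Qs conts op])
      show "endpoint (0, q) \<in> U \<inter> \<alpha> -` A" if "q \<in> {s} \<times> K \<times> tails" for q
        using that \<open>s \<in> ?I\<close> window
        by (auto simp: base intro!: flow_in_box A)
    qed blast
    then show ?thesis
      by (intro exI[of _ e]) auto
  qed
  obtain e2 where e2: "e2 > 0" "\<And>\<epsilon> x r. \<bar>\<epsilon>\<bar> \<le> e2 \<Longrightarrow> x \<in> K \<Longrightarrow> r \<in> tails \<Longrightarrow> \<alpha> (endpoint (\<epsilon>, \<eta>, x, r)) > 0"
    using side[of "{0<..}" \<eta>] alpha_sign(2) window by auto
  obtain e3 where e3: "e3 > 0" "\<And>\<epsilon> x r. \<bar>\<epsilon>\<bar> \<le> e3 \<Longrightarrow> x \<in> K \<Longrightarrow> r \<in> tails \<Longrightarrow> \<alpha> (endpoint (\<epsilon>, - \<eta>, x, r)) < 0"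
    using side[of "{..<0}" "- \<eta>"] alpha_sign(1) window by auto
  \<comment> \<open>On \<open>W\<close> the gradient is smaller than \<open>G\<close> and
    \<open>g\<close> is bounded by \<open>B\<close>. The last entry therefore keeps the term with
    \<open>\<epsilon>\<close> below \<open>a / 2\<close>, against at least \<open>a\<close> from
    \<open>f\<close>.\<close>
  define \<epsilon>0 where "\<epsilon>0 = Min {e1, e2, e3, a / (2 * G * B)}"
  have \<epsilon>0: "0 < \<epsilon>0" "\<epsilon>0 \<le> e1" "\<epsilon>0 \<le> e2" "\<epsilon>0 \<le> e3" "\<epsilon>0 \<le> a / (2 * G * B)"
    using e1 e2 e3 a G B_pos by (auto simp: \<epsilon>0_def)
  show ?thesis
  proof (rule that[OF \<epsilon>0(1)])
    show "\<epsilon>0 \<le> 1"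
      using \<epsilon>0 e1 by simp
    show U: "endpoint (\<epsilon>, s, x, r) \<in> U" if "\<bar>\<epsilon>\<bar> \<le> \<epsilon>0" "s \<in> ?I" "x \<in> K" "r \<in> tails" for \<epsilon> s x r
      using e1(3)[of \<epsilon> "(s, x, r)"] that \<epsilon>0 by (auto simp: Q_def W_def)
    fix \<epsilon> x r
    assume \<epsilon>: "\<bar>\<epsilon>\<bar> \<le> \<epsilon>0" and x: "x \<in> K" and r: "r \<in> tails"
    have xV: "x \<in> V"
      using x assms by blast
    let ?u = "sol \<epsilon> (of_coords \<sigma> (x, r))" and ?t = "rt (\<sigma> x)"
    have u: "endpoint (\<epsilon>, s, x, r) = ?u (?t + s)" if "s \<in> ?I" for s
      using endpoint_sol[OF xV that] .
    have deriv: "\<exists>y. ((\<lambda>s. \<alpha> (?u (?t + s))) has_real_derivative y) (at s) \<and> y > 0" if s: "s \<in> ?I" for s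
    proof -
      let ?v = "f (?u (?t + s)) + \<epsilon> *\<^sub>R g (?u (?t + s - \<tau>))"
      have W: "?u (?t + s) \<in> W"
        using e1(3)[of \<epsilon> "(s, x, r)"] u[OF s] s x r \<epsilon> \<epsilon>0 by (auto simp: Q_def)
      have "((?u \<circ> (\<lambda>s. ?t + s)) has_vector_derivative 1 *\<^sub>R ?v) (at s)"
        using dde_solution_deriv[OF dde_sol time_pos[OF xV s]]
        by (intro vector_diff_chain_at) (auto intro!: derivative_eq_intros)
      then have "((\<lambda>s. \<alpha> (?u (?t + s))) has_real_derivative grad \<alpha> (?u (?t + s)) \<bullet> ?v) (at s)"
        using alpha_chain[of "\<lambda>s. ?u (?t + s)" ?v s] W by (simp add: o_def W_def)
      moreover have "grad \<alpha> (?u (?t + s)) \<bullet> ?v > 0"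
      proof -
        have "\<bar>grad \<alpha> (?u (?t + s)) \<bullet> g (?u (?t + s - \<tau>))\<bar> \<le> G * B"
          using W norm_bound(2) G(1)
          by (intro order_trans[OF Cauchy_Schwarz_ineq2] mult_mono) (auto simp: W_def)
        then have "\<bar>\<epsilon>\<bar> * \<bar>grad \<alpha> (?u (?t + s)) \<bullet> g (?u (?t + s - \<tau>))\<bar> \<le> a / (2 * G * B) * (G * B)"
          using \<epsilon> \<epsilon>0 a G B_pos by (intro mult_mono) auto
        also have "\<dots> = a / 2"
          using G B_pos by simp
        finally have "\<bar>\<epsilon> * (grad \<alpha> (?u (?t + s)) \<bullet> g (?u (?t + s - \<tau>)))\<bar> \<le> a / 2"
          by (simp add: abs_mult)
        moreover have "a \<le> grad \<alpha> (?u (?t + s)) \<bullet> f (?u (?t + s))"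
          using W a by (auto simp: W_def)
        ultimately show ?thesis
          using a(1) by (simp add: inner_add_right)
      qed
      ultimately show ?thesis
        by blast
    qed
    have mono: "\<alpha> (?u (?t + s)) < \<alpha> (?u (?t + s'))" if "s \<in> ?I" "s' \<in> ?I" "s < s'" for s s'
      by (rule DERIV_pos_imp_increasing[OF that(3), of "\<lambda>s. \<alpha> (?u (?t + s))"]) (use deriv that in auto)
    have "continuous_on ?I (\<lambda>s. \<alpha> (?u (?t + s)))"
      using deriv DERIV_isCont by (intro continuous_at_imp_continuous_on) blast
    moreover have "\<alpha> (?u (?t + - \<eta>)) < 0" "0 < \<alpha> (?u (?t + \<eta>))"
      using e2(2)[of \<epsilon> x r] e3(2)[of \<epsilon> x r] u[of \<eta>] u[of "- \<eta>"] \<epsilon> \<epsilon>0 x r window by auto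
    ultimately obtain s where s: "s \<in> ?I" "\<alpha> (?u (?t + s)) = 0"
      using IVT'[of "\<lambda>s. \<alpha> (?u (?t + s))" "- \<eta>" 0 \<eta>] window by force
    have iff: "endpoint (\<epsilon>, s, x, r) \<in> S \<longleftrightarrow> \<alpha> (?u (?t + s)) = 0" if "s \<in> ?I" for s
      using U[OF \<epsilon> that x r] section_iff u[OF that] by metis
    show "\<exists>!s. s \<in> ?I \<and> endpoint (\<epsilon>, s, x, r) \<in> S"
    proof (rule ex1I[of _ s])
      show "s' = s" if "s' \<in> ?I \<and> endpoint (\<epsilon>, s', x, r) \<in> S" for s'
        using that iff s mono by (metis less_irrefl linorder_neqE_linordered_idom)
    qed (use s iff in blast)
  qed
qed

text \<open>The interface between dynamics and covering relations. Continuity is joint in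
  \<open>\<epsilon>\<close> and the history on one fixed product, while the last clause treats the
  variable tails by allowing any \<open>M\<close> between the two constants.\<close>

lemma return_map_coords:
  assumes "compact K" "K \<subseteq> V"
  obtains \<epsilon>0 where "0 < \<epsilon>0" "\<epsilon>0 \<le> 1"
    and "\<And>\<epsilon> x r. \<bar>\<epsilon>\<bar> \<le> \<epsilon>0 \<Longrightarrow> x \<in> K \<Longrightarrow> r \<in> tails \<Longrightarrow>
      \<exists>!t. is_dde_return_time f g \<tau> S \<eta> \<epsilon> (of_coords \<sigma> (x, r)) t"
    and "continuous_on ({- \<epsilon>0..\<epsilon>0} \<times> K \<times> tails)
      (\<lambda>(\<epsilon>, z). to_coords \<kappa> (dde_return_map f g \<tau> S \<eta> \<epsilon> (of_coords \<sigma> z)))"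
    and "\<And>x r. x \<in> K \<Longrightarrow> r \<in> tails \<Longrightarrow>
      fst (to_coords \<kappa> (dde_return_map f g \<tau> S \<eta> 0 (of_coords \<sigma> (x, r)))) = \<kappa> (poincare_map f S (\<sigma> x))"
    and "\<And>\<epsilon> x r M. \<bar>\<epsilon>\<bar> \<le> \<epsilon>0 \<Longrightarrow> x \<in> K \<Longrightarrow> r \<in> lipschitz_tails \<tau> M \<Longrightarrow>
      Mf + \<bar>\<epsilon>\<bar> * Mg \<le> M \<Longrightarrow> M \<le> Mf + Mg \<Longrightarrow>
      snd (to_coords \<kappa> (dde_return_map f g \<tau> S \<eta> \<epsilon> (of_coords \<sigma> (x, r)))) \<in> lipschitz_tails \<tau> M"
proof -
  let ?I = "{- \<eta>..\<eta>}"
  obtain \<epsilon>0 where \<epsilon>0: "0 < \<epsilon>0" "\<epsilon>0 \<le> 1"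
    and U: "\<And>\<epsilon> s x r. \<bar>\<epsilon>\<bar> \<le> \<epsilon>0 \<Longrightarrow> s \<in> ?I \<Longrightarrow> x \<in> K \<Longrightarrow> r \<in> tails \<Longrightarrow> endpoint (\<epsilon>, s, x, r) \<in> U"
    and ex1: "\<And>\<epsilon> x r. \<bar>\<epsilon>\<bar> \<le> \<epsilon>0 \<Longrightarrow> x \<in> K \<Longrightarrow> r \<in> tails \<Longrightarrow> \<exists>!s. s \<in> ?I \<and> endpoint (\<epsilon>, s, x, r) \<in> S"
    using unique_crossing[OF assms] by blast
  define h where "h = (\<lambda>(\<epsilon>, x, r). THE s. s \<in> ?I \<and> endpoint (\<epsilon>, s, x, r) \<in> S)"
  have h: "h (\<epsilon>, x, r) \<in> ?I" "endpoint (\<epsilon>, h (\<epsilon>, x, r), x, r) \<in> S"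
    if "\<bar>\<epsilon>\<bar> \<le> \<epsilon>0" "x \<in> K" "r \<in> tails" for \<epsilon> x r
    using theI'[OF ex1[OF that]] by (simp_all add: h_def)
  have h_eq: "h (\<epsilon>, x, r) = s"
    if "\<bar>\<epsilon>\<bar> \<le> \<epsilon>0" "x \<in> K" "r \<in> tails" "s \<in> ?I" "endpoint (\<epsilon>, s, x, r) \<in> S" for \<epsilon> s x r
    using ex1[OF that(1-3)] h[OF that(1-3)] that(4,5) by blast
  define Z where "Z = {- \<epsilon>0..\<epsilon>0} \<times> K \<times> tails"
  have Z: "compact Z"
    unfolding Z_def using assms pos by (intro compact_Times compact_lipschitz_tails) auto
  let ?j = "\<lambda>((\<epsilon>, x, r), s). (\<epsilon>, s, x, r)"
  have j: "continuous_on A ?j" for A :: "((real \<times> 'm coords \<times> 'd hist) \<times> real) set"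
    unfolding case_prod_beta by (intro continuous_intros)
  have jim: "?j ` (Z \<times> ?I) \<subseteq> {-1..1} \<times> ?I \<times> V \<times> tails"
    using assms \<epsilon>0 by (auto simp: Z_def)
  have conth: "continuous_on Z h"
  proof (rule continuous_on_compact_graph)
    \<comment> \<open>Inside \<open>U\<close> the section is the zero set of
      \<open>\<alpha>\<close>. This makes the graph of \<open>h\<close> closed in a compact set
      without closedness of \<open>S\<close>.\<close>
    have "continuous_on (Z \<times> ?I) (\<lambda>p. \<alpha> (endpoint (?j p)))"
    proof (intro continuous_on_compose2[OF alpha_continuous] continuous_on_compose2[OF continuous_on_endpoint j])
      show "(\<lambda>p. endpoint (?j p)) ` (Z \<times> ?I) \<subseteq> U"
        using U by (auto simp: Z_def abs_le_iff)
    qed (use jim in auto)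
    then have "closed ((Z \<times> ?I) \<inter> (\<lambda>p. \<alpha> (endpoint (?j p))) -` {0})"
      using Z by (intro continuous_closed_preimage closed_Times compact_imp_closed) auto
    then have "compact ((Z \<times> ?I) \<inter> ((Z \<times> ?I) \<inter> (\<lambda>p. \<alpha> (endpoint (?j p))) -` {0}))"
      using Z by (intro compact_Int_closed compact_Times) auto
    moreover have "(Z \<times> ?I) \<inter> ((Z \<times> ?I) \<inter> (\<lambda>p. \<alpha> (endpoint (?j p))) -` {0})
        = {(z, s). z \<in> Z \<and> s \<in> ?I \<and> endpoint (?j (z, s)) \<in> S}"
      using U section_iff by (auto simp: Z_def abs_le_iff)
    ultimately show "compact {(z, s). z \<in> Z \<and> s \<in> ?I \<and> endpoint (?j (z, s)) \<in> S}"
      by simp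
    show "fst ` {(z, s). z \<in> Z \<and> s \<in> ?I \<and> endpoint (?j (z, s)) \<in> S} = Z"
    proof (intro equalityI subsetI)
      fix z assume "z \<in> Z"
      then have "(z, h z) \<in> {(z, s). z \<in> Z \<and> s \<in> ?I \<and> endpoint (?j (z, s)) \<in> S}"
        using h by (auto simp: Z_def abs_le_iff)
      then show "z \<in> fst ` {(z, s). z \<in> Z \<and> s \<in> ?I \<and> endpoint (?j (z, s)) \<in> S}"
        by (rule image_eqI[rotated]) simp
    qed auto
    show "h z = s" if "(z, s) \<in> {(z, s). z \<in> Z \<and> s \<in> ?I \<and> endpoint (?j (z, s)) \<in> S}" for z s
      using that by (auto simp: Z_def abs_le_iff intro!: h_eq)
  qed
  have ret_iff: "is_dde_return_time f g \<tau> S \<eta> \<epsilon> (of_coords \<sigma> (x, r)) t \<longleftrightarrow> t = rt (\<sigma> x) + h (\<epsilon>, x, r)"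
    if "\<bar>\<epsilon>\<bar> \<le> \<epsilon>0" "x \<in> K" "r \<in> tails" for \<epsilon> x r t
  proof -
    have "x \<in> V"
      using that assms by blast
    have "t - rt (\<sigma> x) \<in> ?I \<and> endpoint (\<epsilon>, t - rt (\<sigma> x), x, r) \<in> S \<longleftrightarrow> t - rt (\<sigma> x) = h (\<epsilon>, x, r)"
      using h[OF that] h_eq[OF that] by metis
    then show ?thesis
      unfolding is_dde_return_time_iff[OF \<open>x \<in> V\<close> that(3)] by auto
  qed
  define R where "R = (\<lambda>z. orbit (?j (z, h z)))"
  have R: "dde_return_map f g \<tau> S \<eta> \<epsilon> (of_coords \<sigma> (x, r)) = R (\<epsilon>, x, r)"
    if "\<bar>\<epsilon>\<bar> \<le> \<epsilon>0" "x \<in> K" "r \<in> tails" for \<epsilon> x r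
    unfolding dde_return_map_def ret_iff[OF that] by (simp add: R_def orbit_def)
  have contR: "continuous_on Z R"
    unfolding R_def
  proof (intro continuous_on_compose2[OF continuous_on_orbit] continuous_on_compose2[OF j])
    show "continuous_on Z (\<lambda>z. (z, h z))"
      by (intro continuous_intros conth)
    show "(\<lambda>z. ?j (z, h z)) ` Z \<subseteq> {-1..1} \<times> ?I \<times> V \<times> tails"
      using h(1) assms \<epsilon>0 by (auto simp: Z_def abs_le_iff)
  qed auto
  have RS: "apply_bcontfun (R z) 0 \<in> S" if "z \<in> Z" for z
    using h(2) that by (auto simp: R_def endpoint_def Z_def abs_le_iff)
  have contR0: "continuous_on Z (\<lambda>z. apply_bcontfun (R z) 0)"
    by (rule continuous_on_compose2[OF continuous_on_apply_bcontfun_left[of UNIV] contR]) auto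
  show ?thesis
  proof (rule that[OF \<epsilon>0])
    show "\<exists>!t. is_dde_return_time f g \<tau> S \<eta> \<epsilon> (of_coords \<sigma> (x, r)) t"
      if "\<bar>\<epsilon>\<bar> \<le> \<epsilon>0" "x \<in> K" "r \<in> tails" for \<epsilon> x r
      unfolding ret_iff[OF that] by simp
    have "continuous_on Z (\<lambda>z. to_coords \<kappa> (R z))"
      unfolding to_coords_def
      by (intro continuous_on_Pair continuous_on_diff contR continuous_on_compose2[OF chart_props(4) contR0]
          continuous_on_compose2[OF continuous_on_const_bcontfun contR0]) (use RS in auto)
    moreover have "to_coords \<kappa> (R z) = (\<lambda>(\<epsilon>, z). to_coords \<kappa> (dde_return_map f g \<tau> S \<eta> \<epsilon> (of_coords \<sigma> z))) z"
      if "z \<in> Z" for z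
      using that R by (auto simp: Z_def abs_le_iff)
    ultimately show "continuous_on ({- \<epsilon>0..\<epsilon>0} \<times> K \<times> tails)
        (\<lambda>(\<epsilon>, z). to_coords \<kappa> (dde_return_map f g \<tau> S \<eta> \<epsilon> (of_coords \<sigma> z)))"
      unfolding Z_def[symmetric] by (rule continuous_on_eq)
    show "fst (to_coords \<kappa> (dde_return_map f g \<tau> S \<eta> 0 (of_coords \<sigma> (x, r)))) = \<kappa> (poincare_map f S (\<sigma> x))"
      if "x \<in> K" "r \<in> tails" for x r
    proof -
      have x: "x \<in> V"
        using that assms by blast
      have end0: "endpoint (0, 0, x, r) = poincare_map f S (\<sigma> x)"
        using endpoint_0[OF x _ that(2), of 0] window by (simp add: flow_props)
      \<comment> \<open>At offset 0 the unperturbed orbit is already at a point of \<open>S\<close>,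
        and the crossing is unique.\<close>
      have "h (0, x, r) = 0"
        using that \<epsilon>0 window end0 flow_near_return(2)[OF sigma_in[OF x]] by (intro h_eq) auto
      then show ?thesis
        using R[of 0 x r] that \<epsilon>0 end0 by (simp add: R_def endpoint_def to_coords_def)
    qed
    show "snd (to_coords \<kappa> (dde_return_map f g \<tau> S \<eta> \<epsilon> (of_coords \<sigma> (x, r)))) \<in> lipschitz_tails \<tau> M"
      if "\<bar>\<epsilon>\<bar> \<le> \<epsilon>0" "x \<in> K" "r \<in> lipschitz_tails \<tau> M" "Mf + \<bar>\<epsilon>\<bar> * Mg \<le> M" "M \<le> Mf + Mg" for \<epsilon> x r M
    proof -
      have r: "r \<in> tails"
        using that lipschitz_tails_mono by blast
      have "rt (\<sigma> x) + h (\<epsilon>, x, r) > 0"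
        using time_pos h(1)[OF that(1,2) r] that(2) assms by blast
      then have "R (\<epsilon>, x, r) \<in> lip_hist M"
        unfolding R_def orbit_def using that by (auto intro!: dde_semiflow_lip_hist of_coords_lip_hist)
      then show ?thesis
        using R[OF that(1,2) r] by (simp add: to_coords_def lip_hist_def)
    qed
  qed
qed

end

subsection \<open>Covering relations\<close>

lemma compact_max_ball: "compact (max_ball :: (real^'m::finite) set)"
proof -
  have "closed (max_ball :: (real^'m) set)"
    unfolding max_ball_def by (intro closed_Collect_le continuous_intros)
  moreover have "bounded (max_ball :: (real^'m) set)"
    unfolding bounded_iff max_ball_def
    by (intro exI[of _ "sqrt DIM(real^'m) * 1"] ballI order_trans[OF norm_le_infnorm] mult_left_mono) auto
  ultimately show ?thesis
    by (simp add: compact_eq_bounded_closed)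
qed

lemma compact_max_sphere: "compact (max_sphere :: (real^'m::finite) set)"
proof -
  have "max_sphere = (max_ball :: (real^'m) set) \<inter> {q. infnorm q = 1}"
    by (auto simp: max_sphere_def max_ball_def)
  moreover have "closed {q :: real^'m. infnorm q = 1}"
    by (intro closed_Collect_eq continuous_intros)
  ultimately show ?thesis
    using compact_Int_closed[OF compact_max_ball] by metis
qed

lemma hset_props:
  assumes "is_hset N"
  shows "compact (exit_set N)" "compact (entry_set N)" "exit_set N \<subseteq> supp N" "compact (supp N)"
    and "p \<in> {-1..1} \<Longrightarrow> q \<in> max_ball \<Longrightarrow> inv (coord N) (p, q) \<in> supp N"
proof -
  obtain h where h: "homeomorphism UNIV UNIV (coord N) h"
    and N: "compact (supp N)" "coord N ` supp N = {-1..1} \<times> max_ball"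
    using assms by (auto simp: is_hset_def)
  have hN: "h (coord N x) = x" "coord N (h y) = y" for x y
    using homeomorphism_apply1[OF h] homeomorphism_apply2[OF h] by simp_all
  then have inv: "inv (coord N) = h"
    by (intro inv_equality)
  have conth: "continuous_on A h" for A
    using h by (auto simp: homeomorphism_def intro: continuous_on_subset)
  have sub: "h ` ({-1..1} \<times> max_ball) \<subseteq> supp N"
    using N(2)[symmetric] hN by auto
  show "compact (exit_set N)" "compact (entry_set N)"
    unfolding exit_set_def entry_set_def inv
    by (intro compact_continuous_image[OF conth] compact_Times compact_max_ball compact_max_sphere; simp)+
  show "exit_set N \<subseteq> supp N"
    unfolding exit_set_def inv by (rule order_trans[OF image_mono sub]) auto
  show "p \<in> {-1..1} \<Longrightarrow> q \<in> max_ball \<Longrightarrow> inv (coord N) (p, q) \<in> supp N"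
    using sub unfolding inv by blast
qed (use assms in \<open>simp add: is_hset_def\<close>)

text \<open>With compact tails the domains are compact, so compactness of the return map and of the
  homotopy reduces to continuity.\<close>

lemma compact_map_on_compact:
  fixes F :: "'a::metric_space \<Rightarrow> 'b::metric_space"
  assumes "compact D" "continuous_on D F"
  shows "compact_map_on D F"
  unfolding compact_map_on_def
proof (intro allI impI)
  fix B assume "B \<subseteq> D"
  have "compact (F ` D)"
    using assms by (rule compact_continuous_image[rotated])
  moreover from this have "closure (F ` B) \<subseteq> F ` D"
    using \<open>B \<subseteq> D\<close> by (intro closure_minimal image_mono compact_imp_closed)
  ultimately show "compact (closure (F ` B))"
    by (metis closed_closure compact_Int_closed inf.absorb_iff2)
qed

text \<open>
  The homotopy first moves the head along segments to the finite-dimensional map while it shrinks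
  the tail to 0, and then follows the finite-dimensional homotopy.
\<close>

lemma tailed_covers_near_head:
  fixes N M :: "'m::finite hset"
  assumes "covers N p M"
  shows "\<exists>e>0. \<forall>(X :: 'x::banach set) T F. compact T \<and> convex T \<and> T \<subseteq> X \<and> 0 \<in> T \<and>
    continuous_on (supp N \<times> T) F \<and>
    (\<forall>z\<in>supp N \<times> T. snd (F z) \<in> T \<and> dist (fst (F z)) (p (fst z)) < e) \<longrightarrow>
    tailed_covers X (N, T) F (M, T)"
proof -
  have N: "is_hset N" and M: "is_hset M" and contp: "continuous_on (supp N) p"
    using assms by (auto simp: covers_def)
  obtain H :: "real \<Rightarrow> 'm coords \<Rightarrow> 'm coords" and a where contH: "continuous_on ({0..1} \<times> supp N) (\<lambda>(t, x). H t x)"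
    and H: "\<forall>x\<in>supp N. H 0 x = p x" "\<forall>t\<in>{0..1}. \<forall>x\<in>exit_set N. H t x \<notin> supp M"
      "\<forall>t\<in>{0..1}. \<forall>x\<in>supp N. H t x \<notin> entry_set M"
    and a: "a \<notin> {-1..1}"
    and H': "\<forall>p\<in>{-1..1}. \<forall>q\<in>max_ball. coord M (H 1 (inv (coord N) (p, q))) = (a * p, 0)"
    using assms unfolding covers_def by (elim conjE exE) (rule that)
  note H0 = H(1)[rule_format] and Hexit = H(2)[rule_format] and Hentry = H(3)[rule_format]
    and H1 = H'[rule_format]
  note hN = hset_props[OF N] and hM = hset_props[OF M]
  have comp: "compact (p ` exit_set N)" "compact (p ` supp N)"
    using hN contp by (auto intro!: compact_continuous_image elim: continuous_on_subset)
  \<comment> \<open>The gap \<open>e1\<close> protects the exit condition and \<open>e2\<close> the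
    entry condition while the head moves to \<open>p\<close>.\<close>
  have "p ` exit_set N \<inter> supp M = {}"
    using Hexit[of 0] H0 hN(3) by force
  then obtain e1 where e1: "e1 > 0" "\<And>x y. x \<in> exit_set N \<Longrightarrow> y \<in> supp M \<Longrightarrow> e1 \<le> dist (p x) y"
    using separate_compact_closed[OF comp(1) compact_imp_closed[OF hM(4)]] by auto
  have "p ` supp N \<inter> entry_set M = {}"
    using Hentry[of 0] H0 by force
  then obtain e2 where e2: "e2 > 0" "\<And>x y. x \<in> supp N \<Longrightarrow> y \<in> entry_set M \<Longrightarrow> e2 \<le> dist (p x) y"
    using separate_compact_closed[OF comp(2) compact_imp_closed[OF hM(2)]] by auto
  show ?thesis
  \<comment> \<open>The tolerance is fixed before \<open>T\<close> and \<open>F\<close>, as the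
    tails and the return map vary with \<open>\<epsilon>\<close>.\<close>
  proof (intro exI[of _ "min e1 e2"] conjI allI impI)
    show "min e1 e2 > 0"
      using e1 e2 by simp
    fix X :: "'x set" and T F
    assume *: "compact T \<and> convex T \<and> T \<subseteq> X \<and> 0 \<in> T \<and> continuous_on (supp N \<times> T) F \<and>
      (\<forall>z\<in>supp N \<times> T. snd (F z) \<in> T \<and> dist (fst (F z)) (p (fst z)) < min e1 e2)"
    then have T: "compact T" "convex T" "T \<subseteq> X" "0 \<in> T" and contF: "continuous_on (supp N \<times> T) F"
      by blast+
    have tail: "snd (F z) \<in> T" and close: "dist (fst (F z)) (p (fst z)) < min e1 e2"
      if "z \<in> supp N \<times> T" for z
      using * that by blast+
    \<comment> \<open>\<open>c\<close> falls to 0 during the first half while \<open>b\<close> rests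
      at 0; then \<open>b\<close> rises to 1. One formula covers both stages, so no gluing is
      required.\<close>
    define c :: "real \<Rightarrow> real" where "c t = max 0 (1 - 2 * t)" for t
    define b :: "real \<Rightarrow> real" where "b t = max 0 (2 * t - 1)" for t
    define h where "h = (\<lambda>t z. c t *\<^sub>R (fst (F z) - p (fst z)) + H (b t) (fst z))"
    define G where "G = (\<lambda>t z. (h t z, c t *\<^sub>R snd (F z)))"
    have b: "b t \<in> {0..1}" and c: "c t \<in> {0..1}" if "t \<in> {0..1}" for t
      using that by (auto simp: b_def c_def)
    have D: "compact (supp N \<times> T)" "compact ({0..1::real} \<times> supp N \<times> T)"
      using T hN by (auto intro!: compact_Times)
    have contG: "continuous_on ({0..1} \<times> supp N \<times> T) (\<lambda>(t, z). G t z)"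
    proof -
      let ?D = "{0..1::real} \<times> supp N \<times> T"
      have "continuous_on ?D (\<lambda>w. F (snd w))"
        by (intro continuous_on_compose2[OF contF] continuous_intros) auto
      moreover have "continuous_on ?D (\<lambda>w. p (fst (snd w)))"
        by (intro continuous_on_compose2[OF contp] continuous_intros) auto
      moreover have "continuous_on ?D (\<lambda>w. case (b (fst w), fst (snd w)) of (t, x) \<Rightarrow> H t x)"
        by (rule continuous_on_compose2[OF contH]) (use b in \<open>auto simp: b_def intro!: continuous_intros\<close>)
      moreover have "continuous_on ?D (\<lambda>w. c (fst w))"
        unfolding c_def by (intro continuous_intros)
      ultimately show ?thesis
        unfolding G_def h_def case_prod_beta
        by (intro continuous_on_Pair continuous_on_add continuous_on_scaleR continuous_on_diff
            continuous_on_fst continuous_on_snd) auto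
    qed
    have h: "(dist (p (fst z)) (h t z) < min e1 e2) \<or> (\<exists>s\<in>{0..1}. h t z = H s (fst z))"
      if t: "t \<in> {0..1}" and z: "z \<in> supp N \<times> T" for t z
    proof (cases "t \<le> 1 / 2")
      case True
      then have "h t z = p (fst z) + c t *\<^sub>R (fst (F z) - p (fst z))"
        using H0 z by (auto simp: h_def b_def)
      then have "dist (p (fst z)) (h t z) = c t * dist (fst (F z)) (p (fst z))"
        using c[OF t] by (simp add: dist_norm)
      also have "\<dots> \<le> dist (fst (F z)) (p (fst z))"
        using c[OF t] by (simp add: mult_left_le_one_le)
      finally show ?thesis
        using close[OF z] by simp
    next
      case False
      then show ?thesis
        using b[OF t] by (auto simp: h_def c_def)
    qed
    have closedT: "closed T" "bounded T"
      using T compact_imp_closed compact_imp_bounded by auto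
    have "\<forall>t\<in>{0..1}. \<forall>z\<in>supp N \<times> T. G t z \<in> UNIV \<times> T"
    proof (intro ballI)
      fix t :: real and z assume "t \<in> {0..1}" "z \<in> supp N \<times> T"
      \<comment> \<open>A multiple of a tail by \<open>c t\<close> is a convex combination with
        \<open>0 \<in> T\<close>.\<close>
      then have "(1 - c t) *\<^sub>R 0 + c t *\<^sub>R snd (F z) \<in> T"
        using c tail T by (intro convexD[OF T(2)]) auto
      then show "G t z \<in> UNIV \<times> T"
        by (simp add: G_def)
    qed
    moreover have "\<forall>z\<in>supp N \<times> T. G 0 z = F z"
      using H0 by (auto simp: G_def h_def b_def c_def)
    moreover have "\<forall>t\<in>{0..1}. \<forall>z\<in>exit_set N \<times> T. G t z \<notin> supp M \<times> T"
    proof (intro ballI)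
      fix t :: real and z assume *: "t \<in> {0..1}" "z \<in> exit_set N \<times> T"
      then have "z \<in> supp N \<times> T"
        using hN(3) by auto
      from h[OF *(1) this] have "h t z \<notin> supp M"
        using * e1(2)[of "fst z"] Hexit by fastforce
      then show "G t z \<notin> supp M \<times> T"
        by (simp add: G_def)
    qed
    moreover have "\<forall>t\<in>{0..1}. \<forall>z\<in>supp N \<times> T. G t z \<notin> entry_set M \<times> T"
    proof (intro ballI)
      fix t :: real and z assume *: "t \<in> {0..1}" "z \<in> supp N \<times> T"
      from h[OF *] have "h t z \<notin> entry_set M"
        using * e2(2)[of "fst z"] Hentry by fastforce
      then show "G t z \<notin> entry_set M \<times> T"
        by (simp add: G_def)
    qed
    moreover have "\<forall>p\<in>{-1..1}. \<forall>q\<in>max_ball. \<forall>r\<in>T.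
        map_prod (coord M) id (G 1 (inv (coord N) (p, q), r)) = ((a * p, 0), 0)"
      using H1 by (simp add: G_def h_def b_def c_def)
    moreover have "F ` (supp N \<times> T) \<subseteq> UNIV \<times> X"
      using subsetD[OF T(3) tail] by (intro image_subsetI) (simp only: mem_Times_iff UNIV_I simp_thms)
    ultimately show "tailed_covers X (N, T) F (M, T)"
      unfolding tailed_covers_def is_tailed_hset_def fst_conv snd_conv
      using N M T closedT contF contG D a
      by (intro conjI exI[of _ G] exI[of _ a] bexI[of _ 0] compact_map_on_compact) auto
  qed
qed

theorem theorem28:
  fixes f g :: "real^'d \<Rightarrow> real^'d"
    and \<tau> Mf Mg Lf Lg \<delta> \<eta> :: real
    and S :: "(real^'d) set" and \<alpha> :: "real^'d \<Rightarrow> real"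
    and V :: "'m::finite coords set"
    and \<kappa> :: "real^'d \<Rightarrow> 'm coords" and \<sigma> :: "'m coords \<Rightarrow> real^'d"
    and \<N> :: "'m hset set" and C :: "('m hset \<times> 'm hset) set"
  assumes dim: "CARD('d) = CARD('m) + 2"
    and pos: "\<tau> > 0" "Mf > 0" "Mg > 0" "Lf > 0" "Lg > 0"
    and cont: "continuous_on UNIV f" "continuous_on UNIV g"
    and bound: "\<And>u. infnorm (f u) \<le> Mf" "\<And>u. infnorm (g u) \<le> Mg"
    and lipschitz: "\<And>u v. infnorm (f u - f v) \<le> Lf * infnorm (u - v)"
      "\<And>u v. infnorm (g u - g v) \<le> Lg * infnorm (u - v)"
    and sect: "is_section TYPE('m) f S \<delta> \<alpha>"
    and chart: "coord_diffeo S V \<kappa> \<sigma>"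
    and return: "\<forall>u\<in>S. \<exists>t>0. flow f t u \<in> S"
    and poincare: "continuous_on S (return_time f S)" "continuous_on S (poincare_map f S)"
    and window: "0 < \<eta>" "\<eta> < \<delta>"
    and hsets: "finite \<N>" "\<forall>N\<in>\<N>. is_hset N \<and> supp N \<subseteq> V"
    and rel: "C \<subseteq> \<N> \<times> \<N>"
    and cover: "\<forall>(N, M)\<in>C. covers N (\<lambda>x. \<kappa> (poincare_map f S (\<sigma> x))) M"
  shows "\<exists>\<epsilon>C>0. \<forall>\<epsilon>. \<bar>\<epsilon>\<bar> \<le> \<epsilon>C \<longrightarrow>
    (let T = lipschitz_tails \<tau> (Mf + \<bar>\<epsilon>\<bar> * Mg);
         P = (\<lambda>z. to_coords \<kappa> (dde_return_map f g \<tau> S \<eta> \<epsilon> (of_coords \<sigma> z)))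
     in (\<forall>N\<in>\<N>. \<forall>z\<in>tsupp (N, T). \<exists>!t. is_dde_return_time f g \<tau> S \<eta> \<epsilon> (of_coords \<sigma> z) t) \<and>
        (\<forall>(N, M)\<in>C. tailed_covers (tail_space \<tau>) (N, T) P (M, T)))"
proof -
  interpret section_data f g \<tau> Mf Mg Lf Lg S \<delta> \<alpha> V \<kappa> \<sigma> \<eta>
    by unfold_locales (use assms in auto)
  define p where "p x = \<kappa> (poincare_map f S (\<sigma> x))" for x
  define P where "P \<epsilon> z = to_coords \<kappa> (dde_return_map f g \<tau> S \<eta> \<epsilon> (of_coords \<sigma> z))" for \<epsilon> z
  define T :: "real \<Rightarrow> 'd hist set" where "T \<epsilon> = lipschitz_tails \<tau> (Mf + \<bar>\<epsilon>\<bar> * Mg)" for \<epsilon>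
  define K where "K = (\<Union>N\<in>\<N>. supp N)"
  have K: "compact K" "K \<subseteq> V"
    using hsets by (auto simp: K_def is_hset_def intro!: compact_UN)
  obtain \<epsilon>0 where \<epsilon>0: "0 < \<epsilon>0" "\<epsilon>0 \<le> 1"
    and ex1: "\<And>\<epsilon> x r. \<bar>\<epsilon>\<bar> \<le> \<epsilon>0 \<Longrightarrow> x \<in> K \<Longrightarrow> r \<in> tails \<Longrightarrow>
      \<exists>!t. is_dde_return_time f g \<tau> S \<eta> \<epsilon> (of_coords \<sigma> (x, r)) t"
    and contP: "continuous_on ({- \<epsilon>0..\<epsilon>0} \<times> K \<times> tails) (\<lambda>(\<epsilon>, z). P \<epsilon> z)"
    and P0: "\<And>x r. x \<in> K \<Longrightarrow> r \<in> tails \<Longrightarrow> fst (P 0 (x, r)) = p x"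
    and Ptail: "\<And>\<epsilon> x r M. \<bar>\<epsilon>\<bar> \<le> \<epsilon>0 \<Longrightarrow> x \<in> K \<Longrightarrow> r \<in> lipschitz_tails \<tau> M \<Longrightarrow>
      Mf + \<bar>\<epsilon>\<bar> * Mg \<le> M \<Longrightarrow> M \<le> Mf + Mg \<Longrightarrow> snd (P \<epsilon> (x, r)) \<in> lipschitz_tails \<tau> M"
    unfolding P_def p_def using return_map_coords[OF K] by blast
  have "\<forall>c\<in>C. \<exists>e>0. \<forall>(X :: 'd hist set) T F. compact T \<and> convex T \<and> T \<subseteq> X \<and> 0 \<in> T \<and>
      continuous_on (supp (fst c) \<times> T) F \<and>
      (\<forall>z\<in>supp (fst c) \<times> T. snd (F z) \<in> T \<and> dist (fst (F z)) (p (fst z)) < e) \<longrightarrow>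
      tailed_covers X (fst c, T) F (snd c, T)"
    using cover unfolding p_def[abs_def] by (intro ballI tailed_covers_near_head) auto
  from bchoice[OF this] obtain e where e: "\<forall>c\<in>C. e c > 0 \<and> (\<forall>(X :: 'd hist set) T F.
      compact T \<and> convex T \<and> T \<subseteq> X \<and> 0 \<in> T \<and> continuous_on (supp (fst c) \<times> T) F \<and>
      (\<forall>z\<in>supp (fst c) \<times> T. snd (F z) \<in> T \<and> dist (fst (F z)) (p (fst z)) < e c) \<longrightarrow>
      tailed_covers X (fst c, T) F (snd c, T))" ..
  have finC: "finite C"
    using rel hsets(1) finite_subset by blast
  \<comment> \<open>The inserted 1 covers the case of an empty \<open>C\<close>.\<close>
  define E where "E = Min (insert 1 (e ` C))"
  have E: "E > 0" "\<And>c. c \<in> C \<Longrightarrow> E \<le> e c"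
    using finC e by (auto simp: E_def)
  have "compact ({- \<epsilon>0..\<epsilon>0} \<times> K \<times> tails)"
    using K pos by (intro compact_Times compact_lipschitz_tails) auto
  then have "uniformly_continuous_on ({- \<epsilon>0..\<epsilon>0} \<times> K \<times> tails) (\<lambda>(\<epsilon>, z). P \<epsilon> z)"
    using contP compact_uniformly_continuous by blast
  then obtain d where d: "d > 0" and unif: "\<And>w w'. w \<in> {- \<epsilon>0..\<epsilon>0} \<times> K \<times> tails \<Longrightarrow>
      w' \<in> {- \<epsilon>0..\<epsilon>0} \<times> K \<times> tails \<Longrightarrow> dist w' w < d \<Longrightarrow>
      dist ((\<lambda>(\<epsilon>, z). P \<epsilon> z) w') ((\<lambda>(\<epsilon>, z). P \<epsilon> z) w) < E"
    unfolding uniformly_continuous_on_def using E(1) by meson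
  have main: "(\<forall>N\<in>\<N>. \<forall>z\<in>tsupp (N, T \<epsilon>). \<exists>!t. is_dde_return_time f g \<tau> S \<eta> \<epsilon> (of_coords \<sigma> z) t) \<and>
        (\<forall>(N, M)\<in>C. tailed_covers (tail_space \<tau>) (N, T \<epsilon>) (P \<epsilon>) (M, T \<epsilon>))"
    if \<epsilon>: "\<bar>\<epsilon>\<bar> \<le> min \<epsilon>0 (d / 2)" for \<epsilon>
  proof
    \<comment> \<open>From \<open>\<epsilon>0 \<le> 1\<close>, so all tails lie in the fixed compact
      set.\<close>
    have M: "Mf + \<bar>\<epsilon>\<bar> * Mg \<le> Mf + Mg"
      using \<epsilon> \<epsilon>0 pos by simp
    then have T: "T \<epsilon> \<subseteq> tails"
      by (simp add: T_def lipschitz_tails_mono)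
    show "\<forall>N\<in>\<N>. \<forall>z\<in>tsupp (N, T \<epsilon>). \<exists>!t. is_dde_return_time f g \<tau> S \<eta> \<epsilon> (of_coords \<sigma> z) t"
    proof (intro ballI)
      fix N z assume "N \<in> \<N>" "z \<in> tsupp (N, T \<epsilon>)"
      then have "fst z \<in> K" "snd z \<in> tails"
        using T by (auto simp: K_def)
      then show "\<exists>!t. is_dde_return_time f g \<tau> S \<eta> \<epsilon> (of_coords \<sigma> z) t"
        using ex1[of \<epsilon> "fst z" "snd z"] \<epsilon> by simp
    qed
    have "tailed_covers (tail_space \<tau>) (fst c, T \<epsilon>) (P \<epsilon>) (snd c, T \<epsilon>)" if c: "c \<in> C" for c
    proof (rule bspec[OF e c, THEN conjunct2, rule_format], intro conjI ballI)
      have sub: "supp (fst c) \<subseteq> K"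
        using c rel by (force simp: K_def)
      show "compact (T \<epsilon>)" "convex (T \<epsilon>)" "0 \<in> T \<epsilon>"
        unfolding T_def using pos
        by (auto intro!: compact_lipschitz_tails convex_lipschitz_tails zero_in_lipschitz_tails)
      show "T \<epsilon> \<subseteq> tail_space \<tau>"
        by (auto simp: T_def lipschitz_tails_def)
      have "continuous_on (supp (fst c) \<times> T \<epsilon>) (\<lambda>z. (\<lambda>(\<epsilon>, z). P \<epsilon> z) (\<epsilon>, z))"
        by (rule continuous_on_compose2[OF contP]) (use \<epsilon> sub T in \<open>auto intro!: continuous_intros\<close>)
      then show "continuous_on (supp (fst c) \<times> T \<epsilon>) (P \<epsilon>)"
        by simp
      fix z assume z: "z \<in> supp (fst c) \<times> T \<epsilon>"
      then show "snd (P \<epsilon> z) \<in> T \<epsilon>"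
        using Ptail[of \<epsilon> "fst z" "snd z"] \<epsilon> sub M by (auto simp: T_def)
      have zK: "z \<in> K \<times> tails" "\<epsilon> \<in> {- \<epsilon>0..\<epsilon>0}"
        using z \<epsilon> sub T by (auto simp: abs_le_iff)
      \<comment> \<open>The two points differ only in the parameter, by at most
        \<open>d / 2 < d\<close>, so the estimate is uniform in \<open>z\<close>.\<close>
      have "dist (P \<epsilon> z) (P 0 z) < E"
        using unif[of "(0, z)" "(\<epsilon>, z)"] zK \<epsilon> \<epsilon>0 d by (simp add: dist_Pair_Pair)
      moreover have "fst (P 0 z) = p (fst z)"
        using P0[of "fst z" "snd z"] zK by (simp add: mem_Times_iff)
      ultimately show "dist (fst (P \<epsilon> z)) (p (fst z)) < e c"
        using dist_fst_le[of "P \<epsilon> z" "P 0 z"] E(2)[OF c] by simp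
    qed
    then show "\<forall>(N, M)\<in>C. tailed_covers (tail_space \<tau>) (N, T \<epsilon>) (P \<epsilon>) (M, T \<epsilon>)"
      by force
  qed
  show ?thesis
  proof (intro exI[of _ "min \<epsilon>0 (d / 2)"] conjI allI impI)
    show "min \<epsilon>0 (d / 2) > 0"
      using \<epsilon>0 d by simp
  qed (use main in \<open>simp add: Let_def T_def P_def[abs_def]\<close>)
qed

end
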